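(* Assume the eigenvalues $\lambda_1,\dots,\lambda_N$ of $R_r$ are pairwise distinct, and let all parameters except $\rho$ be fixed. With $Z=\frac{d_1^\tau d_2^\tau\gamma_{th}}{\eta\theta\sigma_1}$ define $$A(\rho)=\frac1\rho\left[\frac{\gamma_{th}d_1^\tau}{(1-\theta)\lambda_1}-\sum_{i=1}^N\frac{\lambda_i^{N-2}}{\prod_{j\ne i}(\lambda_i-\lambda_j)}\,Z\ln\frac{Z}{\lambda_i\rho}\right].$$ Then the outage probability $P_S(\rho)=P\{\gamma_S<\gamma_{th}\}$ satisfies $\lim_{\rho\to\infty}P_S(\rho)/A(\rho)=1$. In particular, for $N\ge2$, $P_S(\rho)$ decays like $\rho^{-1}$ (diversity order one).
   Context: Fix an integer $N\ge 1$ and constants $\eta\in(0,1]$, $\theta\in(0,1)$, $d_1,d_2>0$, $\tau>0$, $\gamma_{th}>0$; $\rho>0$ is the variable. Let $\lambda_1\ge\dots\ge\lambda_N>0$ be the eigenvalues of the receive correlation matrix $R_r$ (an $N\times N$ Hermitian positive definite matrix) and $\sigma_1>0$ the largest eigenvalue of the transmit correlation matrix $R_t$. Let $g_1,\dots,g_N,q$ be i.i.d. zero-mean circularly symmetric complex Gaussian random variables of unit variance, $S=\sum_{i=1}^N\lambda_i|g_i|^2$, and $$\gamma_S=\frac{\frac{\eta\theta(1-\theta)\rho^2}{d_1^{2\tau}d_2^\tau}\,S\,\lambda_1|g_1|^2\,\sigma_1|q|^2}{\frac{\eta\theta\rho}{d_1^\tau d_2^\tau}\,S\,\sigma_1|q|^2+\frac{(1-\theta)\rho}{d_1^\tau}\lambda_1|g_1|^2+1}.$$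 Empty products equal $1$. *)

theory Defs
  imports "HOL-Probability.Probability"
begin

text \<open>Density (w.r.t. Lebesgue measure on the complex plane) of a zero-mean circularly
  symmetric complex Gaussian of unit variance: (1/pi) exp(-|z|^2).\<close>
definition cscg_density :: "complex \<Rightarrow> ennreal" where
  "cscg_density z = ennreal (exp (- (cmod z)\<^sup>2) / pi)"

text \<open>The end-to-end SNR gamma_S, as a function of S, G = |g_1|^2 and Q = |q|^2.\<close>
definition gammaS ::
  "real \<Rightarrow> real \<Rightarrow> real \<Rightarrow> real \<Rightarrow> real \<Rightarrow> real \<Rightarrow> real \<Rightarrow> real \<Rightarrow> real \<Rightarrow> real \<Rightarrow> real \<Rightarrow> real" where
  "gammaS eta theta d1 d2 tau sigma1 lam1 rho S G Q =
     (eta * theta * (1 - theta) * rho\<^sup>2 / (d1 powr (2 * tau) * d2 powr tau) * S * lam1 * G * sigma1 * Q) /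
     (eta * theta * rho / (d1 powr tau * d2 powr tau) * S * sigma1 * Q
      + (1 - theta) * rho / d1 powr tau * lam1 * G + 1)"

definition outage_prob ::
  "'a measure \<Rightarrow> nat \<Rightarrow> (nat \<Rightarrow> 'a \<Rightarrow> complex) \<Rightarrow> ('a \<Rightarrow> complex) \<Rightarrow> (nat \<Rightarrow> real) \<Rightarrow>
   real \<Rightarrow> real \<Rightarrow> real \<Rightarrow> real \<Rightarrow> real \<Rightarrow> real \<Rightarrow> real \<Rightarrow> real \<Rightarrow> real" where
  "outage_prob M N g q lam eta theta d1 d2 tau sigma1 gth rho =
     measure M {\<omega> \<in> space M.
        gammaS eta theta d1 d2 tau sigma1 (lam 1) rho
          (\<Sum>i=1..N. lam i * (cmod (g i \<omega>))\<^sup>2) ((cmod (g 1 \<omega>))\<^sup>2) ((cmod (q \<omega>))\<^sup>2) < gth}"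

definition approxA ::
  "nat \<Rightarrow> (nat \<Rightarrow> real) \<Rightarrow> real \<Rightarrow> real \<Rightarrow> real \<Rightarrow> real \<Rightarrow> real \<Rightarrow> real \<Rightarrow> real \<Rightarrow> real \<Rightarrow> real" where
  "approxA N lam eta theta d1 d2 tau sigma1 gth rho =
     (let Z = d1 powr tau * d2 powr tau * gth / (eta * theta * sigma1) in
      (1 / rho) * (gth * d1 powr tau / ((1 - theta) * lam 1)
        - (\<Sum>i=1..N. lam i powi (int N - 2) / (\<Prod>j\<in>{1..N} - {i}. lam i - lam j)
                       * Z * ln (Z / (lam i * rho)))))"

end

theory Submission
  imports Defs "HOL-Real_Asymp.Real_Asymp"
begin

text \<open>
  With \<open>X = |g 1|\<^sup>2\<close> and \<open>Y = |q|\<^sup>2\<close>, which are standard exponential variables, the SNR has the form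
  \<open>u * v / (u + v + 1)\<close>, where \<open>u = b1 * rho * X\<close> and \<open>v = b2 * rho * S * Y\<close>. It lies below \<open>t\<close> iff
  \<open>u \<le> t\<close> or \<open>v < t * (u + 1) / (u - t)\<close>. The first event contributes \<open>t / (b1 * rho)\<close>. Given \<open>X\<close>
  and \<open>S\<close>, the second has probability about \<open>Z / (rho * S)\<close> with \<open>Z = t / b2\<close>, since \<open>Y\<close> is exponential
  and \<open>u\<close> tends to infinity. For \<open>N \<ge> 2\<close> the variable \<open>1 / S\<close> is integrable, so the outage probability
  times \<open>rho\<close> tends to \<open>t / b1 + Z * E (1 / S)\<close>. The mean of \<open>1 / S\<close> is the integral over \<open>s \<ge> 0\<close> of the
  Laplace transform of \<open>S\<close>, the product of the \<open>1 / (1 + lam i * s)\<close>, and partial fractions give the sum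
  of the \<open>c i * ln (lam i)\<close>; because the \<open>c i\<close> sum to \<open>0\<close>, the terms with \<open>ln rho\<close> in the approximation
  cancel. For \<open>N = 1\<close> the mean of \<open>1 / S\<close> is infinite: truncating it at \<open>X\<close> of order \<open>1 / rho\<close>
  leaves \<open>ln rho / lam 1 + O(1)\<close>.
\<close>

subsection \<open>Partial fractions\<close>

text \<open>Lagrange interpolation of the constant \<open>1\<close> at the nodes
  \<open>- 1 / a i\<close>: the left side is a polynomial in \<open>x\<close> of degree at most
  \<open>card I - 1\<close> that takes the value \<open>1\<close> at \<open>card I\<close> distinct
  points. At the node of \<open>k\<close> every summand but the one of \<open>k\<close> contains the
  vanishing factor \<open>1 + a k * x\<close>.\<close>

lemma homogeneous_Lagrange_identity:
  fixes a :: "'i \<Rightarrow> real"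
  assumes "finite I" "I \<noteq> {}" "inj_on a I" "\<And>i. i \<in> I \<Longrightarrow> a i \<noteq> 0"
  shows "(\<Sum>i\<in>I. a i ^ (card I - 1) / (\<Prod>j\<in>I - {i}. a i - a j) * (\<Prod>j\<in>I - {i}. 1 + a j * x)) = 1"
proof -
  define w where "w i = a i ^ (card I - 1) / (\<Prod>j\<in>I - {i}. a i - a j)" for i
  define p where "p = (\<Sum>i\<in>I. smult (w i) (\<Prod>j\<in>I - {i}. [:1, a j:]))"
  have poly_p: "poly p y = (\<Sum>i\<in>I. w i * (\<Prod>j\<in>I - {i}. 1 + a j * y))" for y
    by (simp add: p_def poly_sum poly_prod mult.commute)
  have card: "card I > 0" using assms by (simp add: card_gt_0_iff)
  have "degree p \<le> card I - 1"
    unfolding p_def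
  proof (rule degree_sum_le[OF \<open>finite I\<close>])
    fix i assume i: "i \<in> I"
    have "degree (\<Prod>j\<in>I - {i}. [:1, a j:]) \<le> (\<Sum>j\<in>I - {i}. degree [:1, a j:])"
      using degree_prod_sum_le[of "I - {i}" "\<lambda>j. [:1, a j:]"] assms(1) by (simp add: o_def)
    also have "\<dots> \<le> (\<Sum>j\<in>I - {i}. 1)"
      by (intro sum_mono) simp
    also have "\<dots> = card I - 1" using i assms(1) by simp
    finally show "degree (smult (w i) (\<Prod>j\<in>I - {i}. [:1, a j:])) \<le> card I - 1"
      using degree_smult_le order_trans by blast
  qed
  have "p = 1"
  proof (rule poly_eqI_degree)
    have inj: "inj_on (\<lambda>i. - 1 / a i) I"
      using assms(3,4) by (auto simp: inj_on_def)
    show "card ((\<lambda>i. - 1 / a i) ` I) > degree p" "card ((\<lambda>i. - 1 / a i) ` I) > degree (1 :: real poly)"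
      using card \<open>degree p \<le> card I - 1\<close> unfolding card_image[OF inj] by auto
    fix y assume "y \<in> (\<lambda>i. - 1 / a i) ` I"
    then obtain k where k: "k \<in> I" "y = - 1 / a k" by auto
    have "poly p y = (\<Sum>i\<in>{k}. w i * (\<Prod>j\<in>I - {i}. 1 + a j * y))"
      unfolding poly_p
    proof (rule sum.mono_neutral_right)
      show "\<forall>i\<in>I - {k}. w i * (\<Prod>j\<in>I - {i}. 1 + a j * y) = 0"
      proof
        fix i assume "i \<in> I - {k}"
        then have "(\<Prod>j\<in>I - {i}. 1 + a j * y) = 0"
          using assms k by (intro prod_zero) (auto intro!: bexI[of _ k])
        then show "w i * (\<Prod>j\<in>I - {i}. 1 + a j * y) = 0" by simp
      qed
    qed (use assms k in auto)
    \<comment> \<open>With the exponent \<open>card I - 1\<close> read as the number of factors,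
      each factor takes one \<open>a k\<close>, and \<open>a k * (1 - a j / a k)\<close> is
      \<open>a k - a j\<close>.\<close>
    also have "\<dots> = (a k ^ (card (I - {k})) * (\<Prod>j\<in>I - {k}. 1 + a j * y)) / (\<Prod>j\<in>I - {k}. a k - a j)"
      using k assms by (simp add: w_def)
    also have "a k ^ (card (I - {k})) * (\<Prod>j\<in>I - {k}. 1 + a j * y) = (\<Prod>j\<in>I - {k}. a k * (1 + a j * y))"
      by (simp add: prod.distrib)
    also have "\<dots> = (\<Prod>j\<in>I - {k}. a k - a j)"
      using assms(4)[OF k(1)] unfolding k(2) by (intro prod.cong) (simp_all add: right_diff_distrib)
    also have "\<dots> / \<dots> = 1"
      using assms k by (auto simp: inj_on_def)
    finally show "poly p y = poly 1 y" by simp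
  qed
  then show ?thesis using poly_p[of x] by (simp add: w_def)
qed

text \<open>The preceding identity divided by the product of all \<open>1 + a i * x\<close>, which
  is nonzero because every factor is positive for \<open>0 \<le> x\<close>.\<close>

lemma partial_fractions_linear:
  fixes a :: "'i \<Rightarrow> real"
  assumes "finite I" "I \<noteq> {}" "inj_on a I" "\<And>i. i \<in> I \<Longrightarrow> 0 < a i" "0 \<le> x"
  shows "(\<Sum>i\<in>I. a i ^ (card I - 1) / (\<Prod>j\<in>I - {i}. a i - a j) * (1 / (1 + a i * x)))
         = (\<Prod>i\<in>I. 1 / (1 + a i * x))"
proof -
  have pos: "1 + a i * x > 0" if "i \<in> I" for i
    using assms(4)[OF that] assms(5) by (simp add: add_pos_nonneg)
  have split: "(\<Prod>j\<in>I. 1 + a j * x) = (1 + a i * x) * (\<Prod>j\<in>I - {i}. 1 + a j * x)" if "i \<in> I" for i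
    using assms(1) that by (simp add: prod.remove)
  have ne: "(\<Prod>j\<in>I. 1 + a j * x) \<noteq> 0"
    using pos assms(1) by force
  have "(\<Sum>i\<in>I. a i ^ (card I - 1) / (\<Prod>j\<in>I - {i}. a i - a j) * (1 / (1 + a i * x)))
      = (\<Sum>i\<in>I. a i ^ (card I - 1) / (\<Prod>j\<in>I - {i}. a i - a j) * (\<Prod>j\<in>I - {i}. 1 + a j * x)
           / (\<Prod>j\<in>I. 1 + a j * x))"
  proof (rule sum.cong[OF refl])
    fix i assume i: "i \<in> I"
    have "(\<Prod>j\<in>I - {i}. 1 + a j * x) / (\<Prod>j\<in>I. 1 + a j * x) = 1 / (1 + a i * x)"
      using ne unfolding split[OF i] by simp
    then show "a i ^ (card I - 1) / (\<Prod>j\<in>I - {i}. a i - a j) * (1 / (1 + a i * x))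
      = a i ^ (card I - 1) / (\<Prod>j\<in>I - {i}. a i - a j) * (\<Prod>j\<in>I - {i}. 1 + a j * x)
           / (\<Prod>j\<in>I. 1 + a j * x)"
      by (metis times_divide_eq_right)
  qed
  also have "\<dots> = 1 / (\<Prod>j\<in>I. 1 + a j * x)"
    unfolding sum_divide_distrib[symmetric]
    by (subst homogeneous_Lagrange_identity) (use assms in \<open>fastforce+\<close>)
  finally show ?thesis
    by (simp add: prod_dividef)
qed

text \<open>Links the natural exponent of the partial fractions to the integer exponent of the
  coefficients in \<open>approxA\<close>.\<close>

lemma power_eq_mult_powi_minus_2:
  fixes x :: "'a :: field"
  assumes "n \<ge> 2"
  shows "x ^ (n - 1) = x * x powi (int n - 2)"
proof -
  obtain m where "n = m + 2" using assms by (metis add.commute le_Suc_ex)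
  then show ?thesis by (simp add: power_int_of_nat)
qed

text \<open>Multiply the partial fraction expansion by \<open>x\<close> and let \<open>x\<close>
  tend to infinity. The sum side tends to the sum in question, while the product side decays like
  \<open>x\<close> to the power \<open>1 - card I\<close>.\<close>

lemma sum_powi_over_differences_eq_0:
  fixes a :: "'i \<Rightarrow> real"
  assumes "finite I" "card I \<ge> 2" "inj_on a I" "\<And>i. i \<in> I \<Longrightarrow> 0 < a i"
  shows "(\<Sum>i\<in>I. a i powi (int (card I) - 2) / (\<Prod>j\<in>I - {i}. a i - a j)) = 0"
proof (rule tendsto_unique)
  have "I \<noteq> {}" using assms(2) by auto
  then obtain k where k: "k \<in> I" by auto
  have powi: "a i ^ (card I - 1) = a i * a i powi (int (card I) - 2)" if "i \<in> I" for i
    using power_eq_mult_powi_minus_2[OF assms(2)] .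
  have lin: "((\<lambda>x. x / (1 + a i * x)) \<longlongrightarrow> 1 / a i) at_top"
            "((\<lambda>x. 1 / (1 + a i * x)) \<longlongrightarrow> 0) at_top" if "i \<in> I" for i
    using assms(4)[OF that] by (real_asymp simp: inverse_eq_divide)+
  show "((\<lambda>x. \<Sum>i\<in>I. a i ^ (card I - 1) / (\<Prod>j\<in>I - {i}. a i - a j) * (x / (1 + a i * x)))
    \<longlongrightarrow> (\<Sum>i\<in>I. a i powi (int (card I) - 2) / (\<Prod>j\<in>I - {i}. a i - a j))) at_top"
  proof (rule tendsto_sum)
    fix i assume i: "i \<in> I"
    have "a i ^ (card I - 1) / (\<Prod>j\<in>I - {i}. a i - a j) * (1 / a i) =
       a i powi (int (card I) - 2) / (\<Prod>j\<in>I - {i}. a i - a j)"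
      using assms(4)[OF i] by (simp add: powi[OF i] del: One_nat_def)
    then show "((\<lambda>x. a i ^ (card I - 1) / (\<Prod>j\<in>I - {i}. a i - a j) * (x / (1 + a i * x)))
       \<longlongrightarrow> a i powi (int (card I) - 2) / (\<Prod>j\<in>I - {i}. a i - a j)) at_top"
      using tendsto_mult[OF tendsto_const lin(1)[OF i], of "a i ^ (card I - 1) / (\<Prod>j\<in>I - {i}. a i - a j)"]
      by (simp del: One_nat_def)
  qed
  have lim: "((\<lambda>x. x / (1 + a k * x) * (\<Prod>i\<in>I - {k}. 1 / (1 + a i * x))) \<longlongrightarrow> 1 / a k * (\<Prod>i\<in>I - {k}. 0)) at_top"
    by (intro tendsto_intros lin k) auto
  \<comment> \<open>The factor of \<open>k\<close> absorbs \<open>x\<close>; since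
    \<open>card I \<ge> 2\<close>, at least one other factor is left to force the limit
    \<open>0\<close>.\<close>
  have zero: "(\<Prod>i\<in>I - {k}. 0::real) = 0"
  proof -
    have "card (I - {k}) > 0" using assms(1,2) k by simp
    then show ?thesis by (simp add: power_0_left)
  qed
  have "((\<lambda>x. x / (1 + a k * x) * (\<Prod>i\<in>I - {k}. 1 / (1 + a i * x))) \<longlongrightarrow> 0) at_top"
    using lim unfolding zero mult_zero_right .
  moreover have "\<forall>\<^sub>F x in at_top. x / (1 + a k * x) * (\<Prod>i\<in>I - {k}. 1 / (1 + a i * x))
     = (\<Sum>i\<in>I. a i ^ (card I - 1) / (\<Prod>j\<in>I - {i}. a i - a j) * (x / (1 + a i * x)))"
    using eventually_ge_at_top[of 0]
  proof eventually_elim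
    case (elim x)
    have "(\<Sum>i\<in>I. a i ^ (card I - 1) / (\<Prod>j\<in>I - {i}. a i - a j) * (x / (1 + a i * x)))
       = x * (\<Sum>i\<in>I. a i ^ (card I - 1) / (\<Prod>j\<in>I - {i}. a i - a j) * (1 / (1 + a i * x)))"
      by (simp add: sum_distrib_left mult_ac)
    also have "\<dots> = x * (\<Prod>i\<in>I. 1 / (1 + a i * x))"
      using assms \<open>I \<noteq> {}\<close> elim by (subst partial_fractions_linear) auto
    also have "\<dots> = x / (1 + a k * x) * (\<Prod>i\<in>I - {k}. 1 / (1 + a i * x))"
      using assms(1) k by (simp add: prod.remove)
    finally show ?case by simp
  qed
  ultimately show "((\<lambda>x. \<Sum>i\<in>I. a i ^ (card I - 1) / (\<Prod>j\<in>I - {i}. a i - a j) * (x / (1 + a i * x)))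
    \<longlongrightarrow> 0) at_top"
    by (rule Lim_transform_eventually)
qed simp

text \<open>By partial fractions the integrand has the antiderivative \<open>F\<close>, a
  combination of the logarithms \<open>ln (1 + a i * x)\<close>, with
  \<open>F 0 = 0\<close>.\<close>

lemma nn_integral_prod_inverse_linear:
  fixes a :: "'i \<Rightarrow> real"
  assumes "finite I" "card I \<ge> 2" "inj_on a I" "\<And>i. i \<in> I \<Longrightarrow> 0 < a i"
  shows "(\<integral>\<^sup>+x. ennreal (\<Prod>i\<in>I. 1 / (1 + a i * x)) * indicator {0..} x \<partial>lborel)
       = ennreal (\<Sum>i\<in>I. a i powi (int (card I) - 2) / (\<Prod>j\<in>I - {i}. a i - a j) * ln (a i))"
proof -
  define c where "c i = a i powi (int (card I) - 2) / (\<Prod>j\<in>I - {i}. a i - a j)" for i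
  define F where "F x = (\<Sum>i\<in>I. c i * ln (1 + a i * x))" for x
  have "I \<noteq> {}" using assms(2) by auto
  have powi: "a i ^ (card I - 1) = a i powi (int (card I) - 2) * a i" if "i \<in> I" for i
    using power_eq_mult_powi_minus_2[OF assms(2), of "a i"] by (simp add: mult.commute)
  have sum_c: "(\<Sum>i\<in>I. c i) = 0"
    unfolding c_def by (rule sum_powi_over_differences_eq_0[OF assms])
  have pos: "1 + a i * x > 0" if "i \<in> I" "0 \<le> x" for i x
    using assms(4)[OF that(1)] that(2) by (simp add: add_pos_nonneg)
  have "(\<integral>\<^sup>+x. ennreal (\<Prod>i\<in>I. 1 / (1 + a i * x)) * indicator {0..} x \<partial>lborel)
      = ennreal ((\<Sum>i\<in>I. c i * ln (a i)) - F 0)"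
  proof (rule nn_integral_FTC_atLeast)
    fix x :: real assume x: "0 \<le> x"
    have "(F has_real_derivative (\<Sum>i\<in>I. c i * (a i / (1 + a i * x)))) (at x)"
      unfolding F_def using pos[OF _ x]
      by (auto intro!: derivative_eq_intros sum.cong)
    also have "(\<Sum>i\<in>I. c i * (a i / (1 + a i * x))) =
       (\<Sum>i\<in>I. a i ^ (card I - 1) / (\<Prod>j\<in>I - {i}. a i - a j) * (1 / (1 + a i * x)))"
      by (intro sum.cong refl, subst powi) (simp_all add: c_def)
    also have "\<dots> = (\<Prod>i\<in>I. 1 / (1 + a i * x))"
      using assms \<open>I \<noteq> {}\<close> x by (intro partial_fractions_linear) auto
    finally show "(F has_real_derivative (\<Prod>i\<in>I. 1 / (1 + a i * x))) (at x)" .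
    show "0 \<le> (\<Prod>i\<in>I. 1 / (1 + a i * x))"
      using pos[OF _ x] by (intro prod_nonneg) (auto simp: less_imp_le)
  next
    \<comment> \<open>Each logarithm diverges on its own. Subtracting \<open>ln x\<close> makes each
      term converge and leaves \<open>F\<close> unchanged, since the \<open>c i\<close> sum to
      \<open>0\<close>.\<close>
    have "((\<lambda>x. ln (1 + a i * x) - ln x) \<longlongrightarrow> ln (a i)) at_top" if "i \<in> I" for i
      using assms(4)[OF that] by real_asymp
    then have "((\<lambda>x. \<Sum>i\<in>I. c i * (ln (1 + a i * x) - ln x)) \<longlongrightarrow> (\<Sum>i\<in>I. c i * ln (a i))) at_top"
      by (intro tendsto_intros) auto
    moreover have "(\<Sum>i\<in>I. c i * (ln (1 + a i * x) - ln x)) = F x" for x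
      using sum_c by (simp add: F_def right_diff_distrib sum_subtractf sum_distrib_right[symmetric])
    ultimately show "(F \<longlongrightarrow> (\<Sum>i\<in>I. c i * ln (a i))) at_top" by simp
  qed measurable
  then show ?thesis by (simp add: F_def c_def)
qed

subsection \<open>Squared moduli of complex Gaussian variables\<close>

lemma nn_integral_exp_tail:
  "(\<integral>\<^sup>+s. ennreal (exp (- s)) * indicator {r..} s \<partial>lborel) = ennreal (exp (- r))"
proof -
  have "((\<lambda>s::real. - exp (- s)) \<longlongrightarrow> 0) at_top" by real_asymp
  then have "(\<integral>\<^sup>+s. ennreal (exp (- s)) * indicator {r..} s \<partial>lborel) = ennreal (0 - (- exp (- r)))"
    by (intro nn_integral_FTC_atLeast) (auto intro!: derivative_eq_intros)
  then show ?thesis by simp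
qed

lemma emeasure_complex_annulus:
  assumes "0 \<le> a" "a \<le> s"
  shows "emeasure lborel {z::complex. a < (cmod z)\<^sup>2 \<and> (cmod z)\<^sup>2 \<le> s} = ennreal (pi * (s - a))"
proof -
  have sq: "(cmod z)\<^sup>2 \<le> b \<longleftrightarrow> cmod z \<le> sqrt b" if "0 \<le> b" for z and b :: real
    using that by (metis norm_ge_zero real_le_rsqrt real_sqrt_ge_zero real_sqrt_pow2 power_mono)
  have eq: "{z::complex. a < (cmod z)\<^sup>2 \<and> (cmod z)\<^sup>2 \<le> s} = cball 0 (sqrt s) - cball 0 (sqrt a)"
    using assms by (auto simp: sq not_le[symmetric])
  have ball: "emeasure lborel (cball (0::complex) (sqrt b)) = ennreal (pi * b)" if "0 \<le> b" for b
    using that by (simp add: emeasure_cball unit_ball_vol_2)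
  have "cball (0::complex) (sqrt a) \<subseteq> cball 0 (sqrt s)"
    using assms by (intro subset_cball real_sqrt_le_mono)
  then show ?thesis
    unfolding eq using assms
    by (subst emeasure_Diff) (auto simp: ball ennreal_minus right_diff_distrib)
qed

text \<open>A layer-cake argument in place of polar coordinates: \<open>exp (- r)\<close> with
  \<open>r = (cmod z)\<^sup>2\<close> is the integral of \<open>exp (- s)\<close> over
  \<open>s \<ge> r\<close>. After exchanging the integrals, the inner one is the area
  \<open>pi * (s - a)\<close> of an annulus, and the factor \<open>pi\<close> cancels.\<close>

lemma nn_integral_cscg_tail:
  assumes "0 \<le> a"
  shows "(\<integral>\<^sup>+z. cscg_density z * indicator {z. a < (cmod z)\<^sup>2} z \<partial>lborel) = ennreal (exp (- a))"
proof -
  have meas: "(\<lambda>(z::complex, s::real). ennreal (exp (- s) / pi) * indicator {s. (cmod z)\<^sup>2 \<le> s} s * indicator {z. a < (cmod z)\<^sup>2} z)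
     \<in> borel_measurable (lborel \<Otimes>\<^sub>M lborel)"
    by (simp add: indicator_def split_beta')
  have "(\<integral>\<^sup>+z. cscg_density z * indicator {z. a < (cmod z)\<^sup>2} z \<partial>lborel)
      = (\<integral>\<^sup>+z. (\<integral>\<^sup>+s. ennreal (exp (- s) / pi) * indicator {s. (cmod z)\<^sup>2 \<le> s} s * indicator {z. a < (cmod z)\<^sup>2} z \<partial>lborel) \<partial>lborel)"
  proof (rule nn_integral_cong)
    fix z :: complex
    have "(\<integral>\<^sup>+s. ennreal (exp (- s) / pi) * indicator {s. (cmod z)\<^sup>2 \<le> s} s * indicator {z. a < (cmod z)\<^sup>2} z \<partial>lborel)
      = (\<integral>\<^sup>+s. ennreal (1 / pi) * indicator {z. a < (cmod z)\<^sup>2} z * (ennreal (exp (- s)) * indicator {(cmod z)\<^sup>2..} s) \<partial>lborel)"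
      by (intro nn_integral_cong) (auto simp: ennreal_mult[symmetric] split: split_indicator)
    also have "\<dots> = ennreal (1 / pi) * indicator {z. a < (cmod z)\<^sup>2} z * ennreal (exp (- (cmod z)\<^sup>2))"
      by (simp add: nn_integral_cmult nn_integral_exp_tail)
    finally show "cscg_density z * indicator {z. a < (cmod z)\<^sup>2} z =
      (\<integral>\<^sup>+s. ennreal (exp (- s) / pi) * indicator {s. (cmod z)\<^sup>2 \<le> s} s * indicator {z. a < (cmod z)\<^sup>2} z \<partial>lborel)"
      by (auto simp: cscg_density_def ennreal_mult[symmetric] split: split_indicator)
  qed
  also have "\<dots> = (\<integral>\<^sup>+s. (\<integral>\<^sup>+z. ennreal (exp (- s) / pi) * indicator {s. (cmod z)\<^sup>2 \<le> s} s * indicator {z. a < (cmod z)\<^sup>2} z \<partial>lborel) \<partial>lborel)"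
    using lborel_pair.Fubini'[OF meas] by simp
  also have "\<dots> = (\<integral>\<^sup>+s. ennreal ((s - a) * exp (- s)) * indicator {a..} s \<partial>lborel)"
  proof (rule nn_integral_cong)
    fix s :: real
    have "(\<integral>\<^sup>+z. ennreal (exp (- s) / pi) * indicator {s. (cmod z)\<^sup>2 \<le> s} s * indicator {z. a < (cmod z)\<^sup>2} z \<partial>lborel)
      = (\<integral>\<^sup>+z. ennreal (exp (- s) / pi) * indicator {z::complex. a < (cmod z)\<^sup>2 \<and> (cmod z)\<^sup>2 \<le> s} z \<partial>lborel)"
      by (intro nn_integral_cong) (auto split: split_indicator)
    also have "\<dots> = ennreal (exp (- s) / pi) * emeasure lborel {z::complex. a < (cmod z)\<^sup>2 \<and> (cmod z)\<^sup>2 \<le> s}"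
      by (rule nn_integral_cmult_indicator) simp
    also have "\<dots> = ennreal ((s - a) * exp (- s)) * indicator {a..} s"
    proof (cases "a \<le> s")
      case True
      then show ?thesis
        using assms by (simp add: emeasure_complex_annulus ennreal_mult'[symmetric] mult.commute)
    next
      case False
      then have empty: "{z::complex. a < (cmod z)\<^sup>2 \<and> (cmod z)\<^sup>2 \<le> s} = {}" by auto
      show ?thesis using False unfolding empty by simp
    qed
    finally show "(\<integral>\<^sup>+z. ennreal (exp (- s) / pi) * indicator {s. (cmod z)\<^sup>2 \<le> s} s * indicator {z. a < (cmod z)\<^sup>2} z \<partial>lborel)
      = ennreal ((s - a) * exp (- s)) * indicator {a..} s" .
  qed
  also have "\<dots> = ennreal (0 - (- (a - a + 1) * exp (- a)))"
  proof (rule nn_integral_FTC_atLeast[where F = "\<lambda>s. - (s - a + 1) * exp (- s)"])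
    show "((\<lambda>s. - (s - a + 1) * exp (- s)) \<longlongrightarrow> 0) at_top" by real_asymp
    show "((\<lambda>s. - (s - a + 1) * exp (- s)) has_real_derivative (s - a) * exp (- s)) (at s)" for s
      by (auto intro!: derivative_eq_intros simp: algebra_simps)
  qed auto
  finally show ?thesis by simp
qed

lemma (in prob_space) exponential_cmod_squared:
  assumes "distributed M lborel f cscg_density"
  shows "distributed M lborel (\<lambda>\<omega>. (cmod (f \<omega>))\<^sup>2) (exponential_density 1)"
proof -
  have f[measurable]: "f \<in> borel_measurable M"
    using distributed_measurable[OF assms] by simp
  have "\<P>(\<omega> in M. (cmod (f \<omega>))\<^sup>2 \<le> a) = 1 - exp (- a)" if "0 \<le> a" for a
  proof -
    have "emeasure M {\<omega> \<in> space M. a < (cmod (f \<omega>))\<^sup>2} = ennreal (exp (- a))"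
    proof -
      have "{\<omega> \<in> space M. a < (cmod (f \<omega>))\<^sup>2} = f -` {z. a < (cmod z)\<^sup>2} \<inter> space M" by auto
      then show ?thesis
        using distributed_emeasure[OF assms, of "{z. a < (cmod z)\<^sup>2}"] nn_integral_cscg_tail[OF that]
        by simp
    qed
    then have "\<P>(\<omega> in M. a < (cmod (f \<omega>))\<^sup>2) = exp (- a)"
      by (simp add: measure_def)
    moreover have "\<P>(\<omega> in M. \<not> a < (cmod (f \<omega>))\<^sup>2) = 1 - \<P>(\<omega> in M. a < (cmod (f \<omega>))\<^sup>2)"
      by (rule prob_neg) simp
    ultimately show ?thesis by (simp add: not_less)
  qed
  then show ?thesis
    by (subst exponential_distributed_iff) auto
qed

text \<open>Conditioning on \<open>V\<close>: the joint law is a product, so the event is integrated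
  section by section, and the section at \<open>v\<close> in \<open>A\<close> has probability
  \<open>1 - exp (- h v)\<close>. Nonnegativity of \<open>h\<close> is what makes this formula for
  the distribution function valid.\<close>

lemma (in prob_space) prob_exponential_less_indep:
  assumes Y: "distributed M lborel Y (exponential_density 1)"
    and V: "V \<in> measurable M K"
    and indep: "distr M (K \<Otimes>\<^sub>M borel) (\<lambda>\<omega>. (V \<omega>, Y \<omega>)) = distr M K V \<Otimes>\<^sub>M distr M borel Y"
    and A: "A \<in> sets K" and h: "h \<in> borel_measurable K" and h0: "\<And>v. 0 \<le> h v"
  shows "\<P>(\<omega> in M. V \<omega> \<in> A \<and> Y \<omega> < h (V \<omega>)) = expectation (\<lambda>\<omega>. indicator A (V \<omega>) * (1 - exp (- h (V \<omega>))))"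
proof -
  note [measurable] = A h V
  have [measurable]: "Y \<in> borel_measurable M"
    using distributed_measurable[OF Y] by simp
  interpret Y: prob_space "distr M borel Y" by (rule prob_space_distr) simp
  have Y_less: "emeasure (distr M borel Y) {..<b} = ennreal (1 - exp (- b))" if "0 \<le> b" for b
  proof -
    have eq: "Y -` {..<b} \<inter> space M = {\<omega> \<in> space M. Y \<omega> < b}" by auto
    \<comment> \<open>The known distribution function concerns \<open>Y \<omega> \<le> b\<close>;
      the strict inequality differs from it only on a null event.\<close>
    have "AE \<omega> in M. Y \<omega> \<noteq> b"
      using distributed_AE2[OF Y, of "\<lambda>y. y \<noteq> b"] AE_lborel_singleton[of b] by (auto elim: eventually_mono)
    then have "\<P>(\<omega> in M. Y \<omega> < b) = \<P>(\<omega> in M. Y \<omega> \<le> b)"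
      by (intro finite_measure_eq_AE) auto
    then have "\<P>(\<omega> in M. Y \<omega> < b) = 1 - exp (- b)"
      using exponential_distributedD_le[OF Y that] by simp
    then show ?thesis
      by (simp add: emeasure_distr eq emeasure_eq_measure)
  qed
  define B where "B = {x \<in> space (K \<Otimes>\<^sub>M borel). fst x \<in> A \<and> snd x < h (fst x)}"
  have B[measurable]: "B \<in> sets (K \<Otimes>\<^sub>M borel)" unfolding B_def by measurable
  have "{\<omega> \<in> space M. V \<omega> \<in> A \<and> Y \<omega> < h (V \<omega>)} = (\<lambda>\<omega>. (V \<omega>, Y \<omega>)) -` B \<inter> space M"
    using measurable_space[OF V] by (auto simp: B_def space_pair_measure)
  then have "emeasure M {\<omega> \<in> space M. V \<omega> \<in> A \<and> Y \<omega> < h (V \<omega>)}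
     = emeasure (distr M (K \<Otimes>\<^sub>M borel) (\<lambda>\<omega>. (V \<omega>, Y \<omega>))) B"
    by (simp add: emeasure_distr)
  also have "\<dots> = (\<integral>\<^sup>+v. emeasure (distr M borel Y) (Pair v -` B) \<partial>distr M K V)"
    unfolding indep by (rule Y.emeasure_pair_measure_alt) simp
  also have "\<dots> = (\<integral>\<^sup>+v. ennreal (indicator A v * (1 - exp (- h v))) \<partial>distr M K V)"
  proof (rule nn_integral_cong)
    fix v assume "v \<in> space (distr M K V)"
    then have "Pair v -` B = (if v \<in> A then {..<h v} else {})"
      by (auto simp: B_def space_pair_measure)
    then show "emeasure (distr M borel Y) (Pair v -` B) = ennreal (indicator A v * (1 - exp (- h v)))"
      by (simp add: Y_less[OF h0])
  qed
  also have "\<dots> = (\<integral>\<^sup>+\<omega>. ennreal (indicator A (V \<omega>) * (1 - exp (- h (V \<omega>)))) \<partial>M)"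
    by (subst nn_integral_distr) auto
  also have "\<dots> = ennreal (expectation (\<lambda>\<omega>. indicator A (V \<omega>) * (1 - exp (- h (V \<omega>)))))"
    using h0 by (intro nn_integral_eq_integral integrable_const_bound[of _ 1])
       (auto intro!: AE_I2 split: split_indicator)
  finally show ?thesis
    using h0 by (simp add: emeasure_eq_measure)
qed

subsection \<open>The inverse moment of a weighted sum of exponential variables\<close>

lemma (in prob_space) AE_exponential_pos:
  assumes "distributed M lborel X (exponential_density 1)"
  shows "AE \<omega> in M. 0 < X \<omega>"
proof -
  have [measurable]: "X \<in> borel_measurable M"
    using distributed_measurable[OF assms] by simp
  have "\<P>(\<omega> in M. 0 < X \<omega>) = 1"
    using exponential_distributedD_gt[OF assms, of 0] by simp
  then show ?thesis
    by (subst (asm) prob_Collect_eq_1) auto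
qed

lemma nn_integral_exp_scaled:
  fixes r :: real
  assumes "0 < r"
  shows "(\<integral>\<^sup>+s. ennreal (exp (- (s * r))) * indicator {0..} s \<partial>lborel) = ennreal (1 / r)"
proof -
  have "(\<integral>\<^sup>+s. ennreal (exp (- (s * r))) * indicator {0..} s \<partial>lborel) = ennreal (0 - (- exp (- (0 * r)) / r))"
  proof (rule nn_integral_FTC_atLeast)
    show "((\<lambda>s. - exp (- (s * r)) / r) \<longlongrightarrow> 0) at_top" using assms by real_asymp
    show "((\<lambda>s. - exp (- (s * r)) / r) has_real_derivative exp (- (s * r))) (at s)" for s
      using assms by (auto intro!: derivative_eq_intros)
  qed auto
  then show ?thesis by simp
qed

lemma (in prob_space) exponential_Laplace_transform:
  assumes "distributed M lborel X (exponential_density 1)" "0 \<le> s"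
  shows "(\<integral>\<^sup>+\<omega>. ennreal (exp (- (s * X \<omega>))) \<partial>M) = ennreal (1 / (1 + s))"
proof -
  have "(\<integral>\<^sup>+\<omega>. ennreal (exp (- (s * X \<omega>))) \<partial>M)
      = (\<integral>\<^sup>+x. ennreal (exponential_density 1 x) * ennreal (exp (- (s * x))) \<partial>lborel)"
    by (rule distributed_nn_integral[OF assms(1), symmetric]) simp
  also have "\<dots> = (\<integral>\<^sup>+x. ennreal (exp (- (x * (1 + s)))) * indicator {0..} x \<partial>lborel)"
    by (intro nn_integral_cong)
       (auto simp: exponential_density_def ennreal_mult[symmetric] exp_add[symmetric] algebra_simps
             split: split_indicator)
  finally show ?thesis
    using assms(2) by (simp add: nn_integral_exp_scaled)
qed

text \<open>For positive \<open>S\<close>, \<open>1 / S\<close> is the integral of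
  \<open>exp (- (s * S))\<close> over \<open>s \<ge> 0\<close>. Exchanging this integral with the
  expectation leaves the Laplace transform of \<open>S\<close>, which factors by
  independence.\<close>

lemma (in prob_space) inverse_moment_weighted_exponentials:
  fixes a :: "'i \<Rightarrow> real"
  assumes I: "finite I" "card I \<ge> 2" and inj: "inj_on a I" and pos: "\<And>i. i \<in> I \<Longrightarrow> 0 < a i"
    and indep: "indep_vars (\<lambda>_. borel) X I"
    and X: "\<And>i. i \<in> I \<Longrightarrow> distributed M lborel (X i) (exponential_density 1)"
  shows "(\<integral>\<^sup>+\<omega>. ennreal (1 / (\<Sum>i\<in>I. a i * X i \<omega>)) \<partial>M)
       = ennreal (\<Sum>i\<in>I. a i powi (int (card I) - 2) / (\<Prod>j\<in>I - {i}. a i - a j) * ln (a i))"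
proof -
  define S where "S \<omega> = (\<Sum>i\<in>I. a i * X i \<omega>)" for \<omega>
  have X_meas[measurable]: "X i \<in> borel_measurable M" if "i \<in> I" for i
    using distributed_measurable[OF X[OF that]] by simp
  have S_meas[measurable]: "S \<in> borel_measurable M" unfolding S_def by measurable
  have "I \<noteq> {}" using I(2) by auto
  have "AE \<omega> in M. \<forall>i\<in>I. 0 < X i \<omega>"
    using I(1) X by (auto intro!: AE_finite_allI AE_exponential_pos)
  then have S_pos: "AE \<omega> in M. 0 < S \<omega>"
  proof eventually_elim
    case (elim \<omega>)
    then show ?case unfolding S_def using I(1) \<open>I \<noteq> {}\<close> pos by (intro sum_pos) auto
  qed
  interpret P: pair_sigma_finite M "lborel :: real measure" ..
  have "(\<integral>\<^sup>+\<omega>. ennreal (1 / S \<omega>) \<partial>M)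
      = (\<integral>\<^sup>+\<omega>. (\<integral>\<^sup>+s. ennreal (exp (- (s * S \<omega>))) * indicator {0..} s \<partial>lborel) \<partial>M)"
    \<comment> \<open>Only almost everywhere: where \<open>S \<omega> = 0\<close>, the inner
      integral is infinite but \<open>1 / S \<omega>\<close> is \<open>0\<close> by
      convention.\<close>
    by (rule nn_integral_cong_AE) (use S_pos in eventually_elim, simp add: nn_integral_exp_scaled)
  also have "\<dots> = (\<integral>\<^sup>+s. (\<integral>\<^sup>+\<omega>. ennreal (exp (- (s * S \<omega>))) * indicator {0..} s \<partial>M) \<partial>lborel)"
    by (rule P.Fubini'[symmetric]) measurable
  also have "\<dots> = (\<integral>\<^sup>+s. ennreal (\<Prod>i\<in>I. 1 / (1 + a i * s)) * indicator {0..} s \<partial>lborel)"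
  proof (rule nn_integral_cong)
    fix s :: real
    show "(\<integral>\<^sup>+\<omega>. ennreal (exp (- (s * S \<omega>))) * indicator {0..} s \<partial>M)
      = ennreal (\<Prod>i\<in>I. 1 / (1 + a i * s)) * indicator {0..} s"
    proof (cases "0 \<le> s")
      case True
      have "(\<integral>\<^sup>+\<omega>. ennreal (exp (- (s * S \<omega>))) \<partial>M) = (\<integral>\<^sup>+\<omega>. (\<Prod>i\<in>I. ennreal (exp (- (s * a i * X i \<omega>)))) \<partial>M)"
        by (simp add: S_def prod_ennreal exp_sum[OF I(1), symmetric] sum_distrib_left sum_negf mult_ac)
      also have "\<dots> = (\<Prod>i\<in>I. \<integral>\<^sup>+\<omega>. ennreal (exp (- (s * a i * X i \<omega>))) \<partial>M)"
        using I(1) by (intro indep_vars_nn_integral indep_vars_compose2[OF indep]) auto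
      also have "\<dots> = (\<Prod>i\<in>I. ennreal (1 / (1 + a i * s)))"
        using True by (intro prod.cong refl, subst exponential_Laplace_transform[OF X])
          (auto simp: mult.commute pos less_imp_le)
      also have "\<dots> = ennreal (\<Prod>i\<in>I. 1 / (1 + a i * s))"
        using True by (intro prod_ennreal) (auto simp: pos less_imp_le)
      finally show ?thesis using True by simp
    qed simp
  qed
  also have "\<dots> = ennreal (\<Sum>i\<in>I. a i powi (int (card I) - 2) / (\<Prod>j\<in>I - {i}. a i - a j) * ln (a i))"
    by (rule nn_integral_prod_inverse_linear[OF I inj pos])
  finally show ?thesis unfolding S_def .
qed

subsection \<open>Asymptotics of the outage probability\<close>

text \<open>Clearing the positive denominator gives \<open>(u - t) * v < t * (u + 1)\<close>, which
  holds for every \<open>v \<ge> 0\<close> once \<open>u \<le> t\<close> and can be solved for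
  \<open>v\<close> otherwise.\<close>

lemma snr_less_iff:
  fixes u v t :: real
  assumes "0 \<le> u" "0 \<le> v" "0 < t"
  shows "u * v / (u + v + 1) < t \<longleftrightarrow> u \<le> t \<or> v < t * (u + 1) / (u - t)"
proof -
  have "u * v / (u + v + 1) < t \<longleftrightarrow> (u - t) * v < t * (u + 1)"
    using assms by (simp add: divide_less_eq algebra_simps)
  also have "\<dots> \<longleftrightarrow> u \<le> t \<or> v < t * (u + 1) / (u - t)"
  proof (cases "u \<le> t")
    case True
    then have "(u - t) * v \<le> 0" using assms by (intro mult_nonpos_nonneg) auto
    moreover have "0 < t * (u + 1)" using assms by simp
    ultimately show ?thesis using True by auto
  next
    case False
    then show ?thesis by (simp add: less_divide_eq mult.commute)
  qed
  finally show ?thesis .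
qed

text \<open>The cut at \<open>u > t * (1 + e)\<close> keeps the conditional outage probability away from the
  pole at \<open>u = t\<close>, where \<open>u = b1 * rho * X\<close>.\<close>
lemma (in prob_space) outage_sandwich:
  fixes X Y S :: "'a \<Rightarrow> real"
  assumes X: "distributed M lborel X (exponential_density 1)" and X0: "\<And>\<omega>. 0 \<le> X \<omega>"
    and Y: "distributed M lborel Y (exponential_density 1)" and Y0: "\<And>\<omega>. 0 \<le> Y \<omega>"
    and S: "AE \<omega> in M. 0 < S \<omega>"
    and S_meas[measurable]: "S \<in> borel_measurable M"
    and indep: "distr M (borel \<Otimes>\<^sub>M borel) (\<lambda>\<omega>. ((X \<omega>, S \<omega>), Y \<omega>))
                = distr M borel (\<lambda>\<omega>. (X \<omega>, S \<omega>)) \<Otimes>\<^sub>M distr M borel Y"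
    and pos: "0 < b1" "0 < b2" "0 < t" "0 < e" "0 < rho"
  defines "P \<equiv> \<P>(\<omega> in M. (b1 * rho * X \<omega>) * (b2 * rho * S \<omega> * Y \<omega>) /
                        (b1 * rho * X \<omega> + b2 * rho * S \<omega> * Y \<omega> + 1) < t)"
    and "D \<equiv> expectation (\<lambda>\<omega>. if t * (1 + e) / b1 / rho < X \<omega>
             then 1 - exp (- (t / b2 * ((b1 * (rho * X \<omega>) + 1) / (b1 * (rho * X \<omega>) - t)) / (rho * S \<omega>))) else 0)"
  shows "1 - exp (- (t / b1 / rho)) + D \<le> P" "P \<le> 1 - exp (- (t * (1 + e) / b1 / rho)) + D"
proof -
  have [measurable]: "X \<in> borel_measurable M" "Y \<in> borel_measurable M"
    using distributed_measurable[OF X] distributed_measurable[OF Y] by simp_all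
  have XS: "(\<lambda>\<omega>. (X \<omega>, S \<omega>)) \<in> borel_measurable M" by measurable
  define k where "k = t * (1 + e) / b1 / rho"
  \<comment> \<open>The absolute value makes \<open>h\<close> nonnegative everywhere, as
    conditioning on \<open>(X, S)\<close> requires; it changes nothing where \<open>X\<close>
    exceeds \<open>k\<close> and \<open>S\<close> is positive.\<close>
  define h where "h p = \<bar>t / b2 * ((b1 * (rho * fst p) + 1) / (b1 * (rho * fst p) - t)) / (rho * snd p)\<bar>" for p
  have kt: "t / b1 / rho \<le> k"
    unfolding k_def using pos by (intro divide_right_mono) auto
  have h_meas: "h \<in> borel_measurable borel"
    unfolding h_def borel_prod[symmetric] by measurable
  have A: "{p :: real \<times> real. k < fst p} \<in> sets borel"
    by (intro borel_open open_Collect_less continuous_intros)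
  define E where "E = {\<omega> \<in> space M. (b1 * rho * X \<omega>) * (b2 * rho * S \<omega> * Y \<omega>) /
                        (b1 * rho * X \<omega> + b2 * rho * S \<omega> * Y \<omega> + 1) < t}"
  define H where "H = {\<omega> \<in> space M. k < X \<omega> \<and> Y \<omega> < h (X \<omega>, S \<omega>)}"
  have [measurable]: "E \<in> sets M" "H \<in> sets M" unfolding E_def H_def h_def by measurable
  have "prob H = expectation (\<lambda>\<omega>. indicator {p. k < fst p} (X \<omega>, S \<omega>) * (1 - exp (- h (X \<omega>, S \<omega>))))"
    using prob_exponential_less_indep[OF Y XS indep A h_meas] by (simp add: H_def h_def)
  also have "\<dots> = D"
    unfolding D_def
  proof (rule integral_cong_AE)
    show "AE \<omega> in M. indicator {p. k < fst p} (X \<omega>, S \<omega>) * (1 - exp (- h (X \<omega>, S \<omega>))) =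
        (if t * (1 + e) / b1 / rho < X \<omega>
         then 1 - exp (- (t / b2 * ((b1 * (rho * X \<omega>) + 1) / (b1 * (rho * X \<omega>) - t)) / (rho * S \<omega>))) else 0)"
      using S
    proof eventually_elim
      case (elim \<omega>)
      show ?case
      proof (cases "k < X \<omega>")
        case True
        then have "t / b1 / rho < X \<omega>" using kt by simp
        then have "t < b1 * (rho * X \<omega>)"
          using pos by (simp add: field_simps)
        then have "0 \<le> t / b2 * ((b1 * (rho * X \<omega>) + 1) / (b1 * (rho * X \<omega>) - t)) / (rho * S \<omega>)"
          using pos elim by (intro divide_nonneg_nonneg mult_nonneg_nonneg) auto
        then have "h (X \<omega>, S \<omega>) =
            t / b2 * ((b1 * (rho * X \<omega>) + 1) / (b1 * (rho * X \<omega>) - t)) / (rho * S \<omega>)"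
          unfolding h_def fst_conv snd_conv by (rule abs_of_nonneg)
        then show ?thesis using True by (simp add: k_def)
      qed (simp add: k_def)
    qed
  qed (auto simp: h_def intro!: borel_measurable_if)
  finally have prob_H: "prob H = D" .
  have iff: "AE \<omega> in M. \<omega> \<in> E \<longleftrightarrow> \<omega> \<in> space M \<and> (X \<omega> \<le> t / b1 / rho \<or> Y \<omega> < h (X \<omega>, S \<omega>))"
    using S
  proof eventually_elim
    case (elim \<omega>)
    have "(b1 * rho * X \<omega>) * (b2 * rho * S \<omega> * Y \<omega>) / (b1 * rho * X \<omega> + b2 * rho * S \<omega> * Y \<omega> + 1) < t
      \<longleftrightarrow> b1 * rho * X \<omega> \<le> t \<or> b2 * rho * S \<omega> * Y \<omega> < t * (b1 * rho * X \<omega> + 1) / (b1 * rho * X \<omega> - t)"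
      using pos elim X0[of \<omega>] Y0[of \<omega>] by (intro snr_less_iff) auto
    moreover have "b1 * rho * X \<omega> \<le> t \<longleftrightarrow> X \<omega> \<le> t / b1 / rho"
      using pos by (simp add: field_simps)
    moreover have "b2 * rho * S \<omega> * Y \<omega> < t * (b1 * rho * X \<omega> + 1) / (b1 * rho * X \<omega> - t) \<longleftrightarrow> Y \<omega> < h (X \<omega>, S \<omega>)"
      if "t < b1 * rho * X \<omega>"
    proof -
      have "h (X \<omega>, S \<omega>) = t * (b1 * rho * X \<omega> + 1) / (b1 * rho * X \<omega> - t) / (b2 * rho * S \<omega>)"
        using that pos elim X0[of \<omega>] by (simp add: h_def mult_ac abs_mult)
      moreover have "0 < b2 * rho * S \<omega>" using pos elim by simp
      ultimately show ?thesis
        by (simp only: pos_less_divide_eq mult.commute)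
    qed
    ultimately show ?case unfolding E_def by auto
  qed
  have le: "prob {\<omega> \<in> space M. X \<omega> \<le> r} = 1 - exp (- r)" if "0 \<le> r" for r
    using exponential_distributedD_le[OF X that] by simp
  \<comment> \<open>The union is disjoint because \<open>H\<close> lies in the region where
    \<open>X\<close> exceeds \<open>k\<close>. Taking \<open>r = t / b1 / rho\<close> gives a set
    inside \<open>E\<close>; taking \<open>r = k\<close> gives one that covers \<open>E\<close>,
    counting the whole strip between the two thresholds as outage.\<close>
  have un: "prob ({\<omega> \<in> space M. X \<omega> \<le> r} \<union> H) = 1 - exp (- r) + D" if "0 \<le> r" "r \<le> k" for r
    using that by (subst finite_measure_Union) (auto simp: le prob_H, auto simp: H_def)
  have "prob ({\<omega> \<in> space M. X \<omega> \<le> t / b1 / rho} \<union> H) \<le> prob E"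
    using iff by (intro finite_measure_mono_AE) (auto simp: H_def)
  then show "1 - exp (- (t / b1 / rho)) + D \<le> P"
    using un[OF _ kt] pos by (simp add: P_def E_def)
  have "prob E \<le> prob ({\<omega> \<in> space M. X \<omega> \<le> k} \<union> H)"
  proof (rule finite_measure_mono_AE)
    show "AE \<omega> in M. \<omega> \<in> E \<longrightarrow> \<omega> \<in> {\<omega> \<in> space M. X \<omega> \<le> k} \<union> H"
      using iff by eventually_elim (use kt in \<open>auto simp: H_def\<close>)
  qed measurable
  then show "P \<le> 1 - exp (- (t * (1 + e) / b1 / rho)) + D"
    using un[of k] pos by (simp add: P_def E_def k_def)
qed

text \<open>The ratio is \<open>1 + (t + 1) / (b * w - t)\<close>. Beyond the cut,
  \<open>b * w - t\<close> is at least the fixed fraction \<open>e / (1 + e)\<close> of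
  \<open>b * w\<close>, so the excess over \<open>1\<close> is of order
  \<open>1 / w\<close>.\<close>

lemma excess_ratio_bounds:
  fixes b t e w :: real
  assumes "0 < b" "0 < t" "0 < e" "t * (1 + e) / b < w"
  shows "1 \<le> (b * w + 1) / (b * w - t)"
    and "(b * w + 1) / (b * w - t) \<le> 1 + (t + 1) * (1 + e) / (e * b) / w"
proof -
  have w: "t * (1 + e) < b * w"
    using assms by (simp add: field_simps)
  have "0 < t * e" using assms by simp
  then have bw: "t < b * w" using w by (simp add: algebra_simps)
  have "0 < w" using bw assms by (metis less_trans zero_less_mult_pos)
  show "1 \<le> (b * w + 1) / (b * w - t)"
    using bw assms(2) by (simp add: le_divide_eq)
  have "(b * w + 1) / (b * w - t) = 1 + (t + 1) / (b * w - t)"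
    using bw by (simp add: field_simps)
  also have "(t + 1) / (b * w - t) \<le> (t + 1) / (e * b * w / (1 + e))"
  proof (rule divide_left_mono)
    show "e * b * w / (1 + e) \<le> b * w - t"
      using w assms by (subst pos_divide_le_eq) (auto simp: algebra_simps)
    show "0 < (b * w - t) * (e * b * w / (1 + e))"
      using bw assms \<open>0 < w\<close> by simp
  qed (use assms in auto)
  also have "\<dots> = (t + 1) * (1 + e) / (e * b) / w" by simp
  finally show "(b * w + 1) / (b * w - t) \<le> 1 + (t + 1) * (1 + e) / (e * b) / w" by simp
qed

text \<open>The quadratic lower bound comes from \<open>exp (- y) \<le> 1 / (1 + y)\<close> and
  \<open>(1 - y + y\<^sup>2) * (1 + y) = 1 + y ^ 3\<close>.\<close>

lemma one_minus_exp_bounds: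
  fixes y :: real
  assumes "0 \<le> y"
  shows "1 - exp (- y) \<le> y" "y - y\<^sup>2 \<le> 1 - exp (- y)" "0 \<le> 1 - exp (- y)"
proof -
  show "1 - exp (- y) \<le> y" using exp_ge_add_one_self[of "- y"] by linarith
  show "0 \<le> 1 - exp (- y)" using assms by simp
  have "exp (- y) \<le> 1 / (1 + y)"
    using assms exp_ge_add_one_self[of y] by (simp add: exp_minus inverse_eq_divide frac_le)
  also have "\<dots> \<le> 1 - y + y\<^sup>2"
    using assms by (subst pos_divide_le_eq) (auto simp: algebra_simps power2_eq_square)
  finally show "y - y\<^sup>2 \<le> 1 - exp (- y)" by simp
qed

text \<open>Dominated convergence, with the factor \<open>rho\<close> moved inside the expectation.
  For fixed positive \<open>X\<close> and \<open>S\<close> the cut is eventually passed, the ratio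
  tends to \<open>1\<close> and the integrand to \<open>Z / S\<close>.\<close>

lemma (in prob_space) conditional_outage_limit:
  fixes X S :: "'a \<Rightarrow> real"
  assumes [measurable]: "X \<in> borel_measurable M" "S \<in> borel_measurable M"
    and X: "AE \<omega> in M. 0 < X \<omega>" and S: "AE \<omega> in M. 0 < S \<omega>"
    and int: "integrable M (\<lambda>\<omega>. 1 / S \<omega>)"
    and pos: "0 < b" "0 < t" "0 < e" "0 < Z"
  shows "((\<lambda>rho. rho * expectation (\<lambda>\<omega>. if t * (1 + e) / b / rho < X \<omega>
             then 1 - exp (- (Z * ((b * (rho * X \<omega>) + 1) / (b * (rho * X \<omega>) - t)) / (rho * S \<omega>))) else 0))
         \<longlongrightarrow> Z * expectation (\<lambda>\<omega>. 1 / S \<omega>)) at_top"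
proof -
  define k where "k = t * (1 + e) / b"
  define C where "C = (t + 1) * (1 + e) / (e * b)"
  have "0 < k" "0 < C" using pos by (auto simp: k_def C_def)
  define f where "f rho \<omega> = rho * (if k / rho < X \<omega>
     then 1 - exp (- (Z * ((b * (rho * X \<omega>) + 1) / (b * (rho * X \<omega>) - t)) / (rho * S \<omega>))) else 0)" for rho \<omega>
  have f_meas[measurable]: "f rho \<in> borel_measurable M" for rho
    unfolding f_def by measurable
  have "((\<lambda>rho. expectation (f rho)) \<longlongrightarrow> expectation (\<lambda>\<omega>. Z / S \<omega>)) at_top"
  proof (rule integral_dominated_convergence_at_top)
    \<comment> \<open>The majorant uses \<open>1 - exp (- y) \<le> y\<close>, which cancels
      \<open>rho\<close>, and the bound \<open>1 + C / k\<close> for the ratio, valid for all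
      \<open>w > k\<close>.\<close>
    show "integrable M (\<lambda>\<omega>. Z * (1 + C / k) * (1 / S \<omega>))"
      by (intro integrable_mult_right int)
    show "\<forall>\<^sub>F rho in at_top. AE \<omega> in M. norm (f rho \<omega>) \<le> Z * (1 + C / k) * (1 / S \<omega>)"
      using eventually_gt_at_top[of 0]
    proof eventually_elim
      case (elim rho)
      show ?case using S
      proof eventually_elim
        case (elim \<omega>)
        show ?case
        proof (cases "k / rho < X \<omega>")
          case True
          define w where "w = rho * X \<omega>"
          have w: "k < w" using True \<open>0 < rho\<close> by (simp add: w_def field_simps)
          note r = excess_ratio_bounds[OF pos(1-3), of w, folded k_def C_def, OF w]
          define y where "y = Z * ((b * w + 1) / (b * w - t)) / (rho * S \<omega>)"
          have "0 \<le> (b * w + 1) / (b * w - t)" using r(1) by linarith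
          then have "0 \<le> y"
            unfolding y_def using pos \<open>0 < rho\<close> elim
            by (intro divide_nonneg_nonneg[OF mult_nonneg_nonneg]) auto
          have "norm (f rho \<omega>) = rho * (1 - exp (- y))"
            using True \<open>0 < rho\<close> \<open>0 \<le> y\<close> by (simp add: f_def y_def w_def)
          also have "\<dots> \<le> rho * y"
            using one_minus_exp_bounds(1)[OF \<open>0 \<le> y\<close>] \<open>0 < rho\<close> by simp
          also have "\<dots> = Z * ((b * w + 1) / (b * w - t)) / S \<omega>"
            using \<open>0 < rho\<close> by (simp add: y_def)
          also have "\<dots> \<le> Z * (1 + C / k) / S \<omega>"
          proof (intro divide_right_mono mult_left_mono)
            have "C / w \<le> C / k" using w \<open>0 < k\<close> \<open>0 < C\<close> by (intro divide_left_mono) auto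
            then show "(b * w + 1) / (b * w - t) \<le> 1 + C / k" using r(2) by linarith
          qed (use pos elim in auto)
          finally show ?thesis by simp
        next
          case False
          then show ?thesis using pos elim \<open>0 < k\<close> \<open>0 < C\<close> by (simp add: f_def)
        qed
      qed
    qed
    show "AE \<omega> in M. ((\<lambda>rho. f rho \<omega>) \<longlongrightarrow> Z / S \<omega>) at_top"
      using X S
    proof eventually_elim
      case (elim \<omega>)
      have "((\<lambda>rho. rho * (1 - exp (- (Z * ((b * (rho * x) + 1) / (b * (rho * x) - t)) / (rho * s))))) \<longlongrightarrow> Z / s) at_top"
        if "0 < x" "0 < s" for x s :: real
        using that pos by (real_asymp simp: field_simps)
      from this[OF elim] show ?case
      proof (rule Lim_transform_eventually)
        have "\<forall>\<^sub>F rho in at_top. k / X \<omega> < rho" by (rule eventually_gt_at_top)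
        then show "\<forall>\<^sub>F rho in at_top. rho * (1 - exp (- (Z * ((b * (rho * X \<omega>) + 1) / (b * (rho * X \<omega>) - t)) / (rho * S \<omega>)))) = f rho \<omega>"
        proof eventually_elim
          case (elim rho)
          then have "0 < rho" using \<open>0 < k\<close> \<open>0 < X \<omega>\<close> by (meson divide_pos_pos less_trans)
          then have "k / rho < X \<omega>" using elim \<open>0 < X \<omega>\<close> by (simp add: field_simps)
          then show ?case by (simp add: f_def)
        qed
      qed
    qed
  qed measurable
  moreover have "expectation (\<lambda>\<omega>. Z / S \<omega>) = Z * expectation (\<lambda>\<omega>. 1 / S \<omega>)"
    using integral_mult_right_zero[of M Z "\<lambda>\<omega>. 1 / S \<omega>"] by simp
  ultimately show ?thesis
    unfolding f_def k_def integral_mult_right_zero by simp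
qed

section \<open>Truncated inverse moments and logarithmic growth\<close>

text \<open>The density is at most \<open>1\<close>, so the integral of \<open>1 / x\<^sup>2\<close>
  from \<open>a\<close> on is an upper bound. With \<open>a\<close> of order \<open>1 / rho\<close>
  this is of order \<open>rho\<close>, which a prefactor \<open>1 / rho\<close> turns into a bounded
  error.\<close>

lemma (in prob_space) exponential_truncated_inverse_square:
  assumes X: "distributed M lborel X (exponential_density 1)" and "0 < a"
  shows "expectation (\<lambda>\<omega>. if a < X \<omega> then 1 / (X \<omega>)\<^sup>2 else 0) \<le> 1 / a"
proof -
  have [measurable]: "X \<in> borel_measurable M"
    using distributed_measurable[OF X] by simp
  have "(\<integral>\<^sup>+\<omega>. ennreal (if a < X \<omega> then 1 / (X \<omega>)\<^sup>2 else 0) \<partial>M)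
     = (\<integral>\<^sup>+x. ennreal (exponential_density 1 x) * ennreal (if a < x then 1 / x\<^sup>2 else 0) \<partial>lborel)"
    by (rule distributed_nn_integral[OF X, symmetric]) simp
  also have "\<dots> \<le> (\<integral>\<^sup>+x. ennreal (1 / x\<^sup>2) * indicator {a..} x \<partial>lborel)"
  proof (rule nn_integral_mono)
    fix x :: real
    have "exponential_density 1 x * (if a < x then 1 / x\<^sup>2 else 0) \<le> 1 / x\<^sup>2 * indicator {a..} x"
      using \<open>0 < a\<close> by (auto simp: exponential_density_def divide_le_cancel split: split_indicator)
    then show "ennreal (exponential_density 1 x) * ennreal (if a < x then 1 / x\<^sup>2 else 0)
      \<le> ennreal (1 / x\<^sup>2) * indicator {a..} x"
      by (auto simp: ennreal_mult'[symmetric] exponential_density_nonneg intro!: ennreal_leI split: split_indicator)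
  qed
  also have "\<dots> = ennreal (0 - (- (1 / a)))"
  proof (rule nn_integral_FTC_atLeast[where F = "\<lambda>x. - (1 / x)"])
    show "((\<lambda>x::real. - (1 / x)) \<longlongrightarrow> 0) at_top" by real_asymp
    show "((\<lambda>x. - (1 / x)) has_real_derivative 1 / x\<^sup>2) (at x)" if "a \<le> x" for x
      using that \<open>0 < a\<close> by (auto intro!: derivative_eq_intros simp: power2_eq_square)
  qed auto
  finally have le: "(\<integral>\<^sup>+\<omega>. ennreal (if a < X \<omega> then 1 / (X \<omega>)\<^sup>2 else 0) \<partial>M) \<le> ennreal (1 / a)" by simp
  have "expectation (\<lambda>\<omega>. if a < X \<omega> then 1 / (X \<omega>)\<^sup>2 else 0)
     = enn2real (\<integral>\<^sup>+\<omega>. ennreal (if a < X \<omega> then 1 / (X \<omega>)\<^sup>2 else 0) \<partial>M)"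
    by (rule integral_eq_nn_integral) auto
  also have "\<dots> \<le> 1 / a"
    using enn2real_mono[OF le] \<open>0 < a\<close> by simp
  finally show ?thesis .
qed

text \<open>On the interval from \<open>a\<close> to \<open>1\<close> the density lies between
  \<open>1 - x\<close> and \<open>1\<close>, so the integrand lies between \<open>1 / x - 1\<close>
  and \<open>1 / x\<close>.\<close>

lemma (in prob_space) exponential_truncated_inverse:
  assumes X: "distributed M lborel X (exponential_density 1)" and a: "0 < a" "a \<le> 1"
  shows "expectation (\<lambda>\<omega>. if a < X \<omega> \<and> X \<omega> \<le> 1 then 1 / X \<omega> else 0) \<le> - ln a"
    and "- ln a - 1 \<le> expectation (\<lambda>\<omega>. if a < X \<omega> \<and> X \<omega> \<le> 1 then 1 / X \<omega> else 0)"
proof -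
  define g where "g x = exponential_density 1 x * (if a < x \<and> x \<le> 1 then 1 / x else 0)" for x :: real
  have eq: "expectation (\<lambda>\<omega>. if a < X \<omega> \<and> X \<omega> \<le> 1 then 1 / X \<omega> else 0) = (\<integral>x. g x \<partial>lborel)"
    unfolding g_def by (rule distributed_integral[OF X, symmetric]) (auto simp: exponential_density_nonneg)
  have up: "has_bochner_integral lborel (\<lambda>x. 1 / x * indicator {a..1} x) (ln 1 - ln a)"
    by (rule has_bochner_integral_FTC_Icc_nonneg[where F = ln])
       (use a in \<open>auto intro!: derivative_eq_intros\<close>)
  have up1: "has_bochner_integral lborel (\<lambda>x::real. 1 * indicator {a..1} x) (1 - a)"
    by (rule has_bochner_integral_FTC_Icc_nonneg[where F = "\<lambda>x. x"])
       (use a in \<open>auto intro!: derivative_eq_intros\<close>)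
  have lo: "has_bochner_integral lborel (\<lambda>x. 1 / x * indicator {a..1} x - 1 * indicator {a..1} x) ((ln 1 - ln a) - (1 - a))"
    by (rule has_bochner_integral_diff[OF up up1])
  have g_up: "g x \<le> 1 / x * indicator {a..1} x" "0 \<le> g x" for x
    using a by (auto simp: g_def exponential_density_def divide_le_cancel split: split_indicator)
  have g_int: "integrable lborel g"
  proof (rule Bochner_Integration.integrable_bound)
    show "integrable lborel (\<lambda>x. 1 / x * indicator {a..1} x)"
      using up by (rule integrable.intros)
    show "g \<in> borel_measurable lborel" unfolding g_def by measurable
    show "AE x in lborel. norm (g x) \<le> norm (1 / x * indicator {a..1} x)"
      using order_trans[OF g_up(1) abs_ge_self] g_up(2)
      by (intro AE_I2) (simp only: real_norm_def abs_of_nonneg)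
  qed
  have "(\<integral>x. g x \<partial>lborel) \<le> (\<integral>x. 1 / x * indicator {a..1} x \<partial>lborel)"
    using g_int up[THEN integrable.intros] g_up by (intro integral_mono) auto
  then show "expectation (\<lambda>\<omega>. if a < X \<omega> \<and> X \<omega> \<le> 1 then 1 / X \<omega> else 0) \<le> - ln a"
    using has_bochner_integral_integral_eq[OF up] eq by simp
  have "(\<integral>x. 1 / x * indicator {a..1} x - 1 * indicator {a..1} x \<partial>lborel) \<le> (\<integral>x. g x \<partial>lborel)"
  proof (rule integral_mono_AE[OF lo[THEN integrable.intros] g_int])
    \<comment> \<open>The point \<open>a\<close> is set aside: it belongs to the closed interval on
      the left, but \<open>g\<close> vanishes there.\<close>
    show "AE x in lborel. 1 / x * indicator {a..1} x - 1 * indicator {a..1} x \<le> g x"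
      using AE_lborel_singleton[of a]
    proof eventually_elim
      case (elim x)
      show ?case
      proof (cases "a < x \<and> x \<le> 1")
        case True
        then have "0 < x" using a by simp
        have "(1 - x) * (1 / x) \<le> exp (- x) * (1 / x)"
          using exp_ge_add_one_self[of "- x"] \<open>0 < x\<close> by (intro mult_right_mono) auto
        moreover have "(1 - x) * (1 / x) = 1 / x - 1" using \<open>0 < x\<close> by (simp add: field_simps)
        ultimately show ?thesis using True \<open>0 < x\<close> by (simp add: g_def exponential_density_def)
      next
        case False
        then show ?thesis using elim by (auto simp: g_def split: split_indicator)
      qed
    qed
  qed
  then show "- ln a - 1 \<le> expectation (\<lambda>\<omega>. if a < X \<omega> \<and> X \<omega> \<le> 1 then 1 / X \<omega> else 0)"
    using has_bochner_integral_integral_eq[OF lo] eq a by simp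
qed

text \<open>The case where \<open>S\<close> is a multiple of \<open>X\<close>, whose factor is
  absorbed into \<open>c\<close>. The integrand times \<open>rho\<close> is \<open>c / X\<close> up
  to errors of order \<open>1 / (rho * X\<^sup>2)\<close>; truncation at \<open>a = k / rho\<close>
  gives \<open>c * ln rho\<close> from the first and a bounded amount from the second.\<close>

lemma (in prob_space) conditional_outage_log_asymptotics:
  assumes X: "distributed M lborel X (exponential_density 1)"
    and pos: "0 < b" "0 < t" "0 < e" "0 < c"
  shows "\<exists>K. \<forall>rho \<ge> max 1 (t * (1 + e) / b).
           \<bar>rho * expectation (\<lambda>\<omega>. if t * (1 + e) / b / rho < X \<omega>
             then 1 - exp (- (c * ((b * (rho * X \<omega>) + 1) / (b * (rho * X \<omega>) - t)) / (rho * X \<omega>))) else 0)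
            - c * ln rho\<bar> \<le> K"
proof -
  have [measurable]: "X \<in> borel_measurable M"
    using distributed_measurable[OF X] by simp
  define k where "k = t * (1 + e) / b"
  define C where "C = (t + 1) * (1 + e) / (e * b)"
  \<comment> \<open>One constant for both error terms: \<open>c * C\<close> bounds the excess of the
    ratio over \<open>1\<close> in the upper estimate, \<open>c\<^sup>2\<close> the quadratic
    remainder of the exponential in the lower one.\<close>
  define B where "B = c * C + c\<^sup>2"
  have "0 < k" "0 < C" using pos by (auto simp: k_def C_def)
  then have "0 < B" using pos by (auto simp: B_def add_pos_pos)
  show ?thesis
    unfolding k_def[symmetric]
  proof (intro exI[of _ "c * \<bar>ln k\<bar> + c + B / k"] allI impI)
    fix rho assume "max 1 k \<le> rho"
    then have rho: "1 \<le> rho" "k \<le> rho" by auto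
    define a where "a = k / rho"
    have a: "0 < a" "a \<le> 1" using rho \<open>0 < k\<close> by (auto simp: a_def)
    define f where "f \<omega> = (if a < X \<omega> then 1 - exp (- (c * ((b * (rho * X \<omega>) + 1) / (b * (rho * X \<omega>) - t)) / (rho * X \<omega>))) else 0)" for \<omega>
    define J where "J \<omega> = (if a < X \<omega> \<and> X \<omega> \<le> 1 then 1 / X \<omega> else 0)" for \<omega>
    define Q where "Q \<omega> = (if a < X \<omega> then 1 / (X \<omega>)\<^sup>2 else 0)" for \<omega>
    have [measurable]: "f \<in> borel_measurable M" "J \<in> borel_measurable M" "Q \<in> borel_measurable M"
      unfolding f_def J_def Q_def by measurable
    \<comment> \<open>The summand \<open>c\<close> pays for the values of \<open>X\<close> above
      \<open>1\<close>, where \<open>J\<close> is \<open>0\<close> but \<open>c / X\<close> is at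
      most \<open>c\<close>.\<close>
    have bounds: "rho * f \<omega> \<le> c * J \<omega> + c + B / rho * Q \<omega> \<and> c * J \<omega> - B / rho * Q \<omega> \<le> rho * f \<omega> \<and> 0 \<le> f \<omega> \<and> f \<omega> \<le> 1" for \<omega>
    proof (cases "a < X \<omega>")
      case True
      define w where "w = rho * X \<omega>"
      have "0 < X \<omega>" using True a by simp
      have w: "k < w" using True rho by (simp add: w_def a_def field_simps)
      then have "0 < w" using \<open>0 < k\<close> by simp
      note r = excess_ratio_bounds[OF pos(1-3), of w, folded k_def C_def, OF w]
      define y where "y = c * ((b * w + 1) / (b * w - t)) / w"
      have y1: "c / w \<le> y"
        unfolding y_def using mult_left_mono[OF r(1), of c] pos \<open>0 < w\<close>
        by (intro divide_right_mono) auto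
      have y2: "y \<le> c / w + c * C / w\<^sup>2"
      proof -
        have "y \<le> c * (1 + C / w) / w"
          unfolding y_def using r(2) pos \<open>0 < w\<close> by (intro divide_right_mono mult_left_mono) auto
        then show ?thesis using \<open>0 < w\<close> by (simp add: field_simps power2_eq_square)
      qed
      have cw: "0 \<le> c / w" using pos \<open>0 < w\<close> by simp
      have "0 \<le> y" using y1 cw by linarith
      have f: "f \<omega> = 1 - exp (- y)" using True by (simp add: f_def y_def w_def)
      have "f \<omega> \<le> c / w + c * C / w\<^sup>2"
        using one_minus_exp_bounds(1)[OF \<open>0 \<le> y\<close>] y2 f by linarith
      also have "\<dots> \<le> c / w + B / w\<^sup>2"
        by (auto simp: B_def intro!: divide_right_mono)
      finally have up: "f \<omega> \<le> c / w + B / w\<^sup>2" .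
      have "c / w - B / w\<^sup>2 \<le> c / w - c\<^sup>2 / w\<^sup>2"
        using pos \<open>0 < C\<close> by (auto simp: B_def intro!: divide_right_mono)
      also have "\<dots> \<le> 1 - exp (- (c / w))"
        using one_minus_exp_bounds(2)[OF cw] by (simp add: power_divide)
      also have "\<dots> \<le> f \<omega>" using y1 f by simp
      finally have lo: "c / w - B / w\<^sup>2 \<le> f \<omega>" .
      have e1: "rho * (c / w) = c / X \<omega>" "rho * (B / w\<^sup>2) = B / rho * (1 / (X \<omega>)\<^sup>2)"
        using rho by (auto simp: w_def power2_eq_square)
      have up': "rho * f \<omega> \<le> c / X \<omega> + B / rho * (1 / (X \<omega>)\<^sup>2)"
        using mult_left_mono[OF up, of rho] rho e1 by (simp add: distrib_left)
      have lo': "c / X \<omega> - B / rho * (1 / (X \<omega>)\<^sup>2) \<le> rho * f \<omega>"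
        using mult_left_mono[OF lo, of rho] rho e1 by (simp add: right_diff_distrib)
      have f01: "0 \<le> f \<omega>" "f \<omega> \<le> 1" using f \<open>0 \<le> y\<close> by auto
      have Q: "Q \<omega> = 1 / (X \<omega>)\<^sup>2" using True by (simp add: Q_def)
      have "c * J \<omega> \<le> c / X \<omega> \<and> c / X \<omega> \<le> c * J \<omega> + c"
      proof (cases "X \<omega> \<le> 1")
        case False
        then have "c / X \<omega> \<le> c" using pos by (simp add: divide_le_eq)
        then show ?thesis using False pos by (simp add: J_def)
      qed (use True pos in \<open>simp add: J_def\<close>)
      then show ?thesis using up' lo' f01 unfolding Q by linarith
    next
      case False
      then show ?thesis using pos by (simp add: f_def J_def Q_def)
    qed
    have int_f: "integrable M f"
      using bounds by (intro integrable_const_bound[of _ 1]) (auto intro!: AE_I2)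
    have int_J: "integrable M J"
      using a by (intro integrable_const_bound[of _ "1 / a"])
         (auto intro!: AE_I2 simp: J_def frac_le)
    have int_Q: "integrable M Q"
      using a by (intro integrable_const_bound[of _ "1 / a\<^sup>2"])
         (auto intro!: AE_I2 simp: Q_def frac_le power_mono)
    have Q_le: "B / rho * expectation Q \<le> B / k"
    proof -
      have "expectation Q \<le> 1 / a"
        unfolding Q_def by (rule exponential_truncated_inverse_square[OF X a(1)])
      then have "B / rho * expectation Q \<le> B / rho * (1 / a)"
        using \<open>0 < B\<close> rho by (intro mult_left_mono) auto
      also have "\<dots> = B / k" using rho by (simp add: a_def)
      finally show ?thesis .
    qed
    have ln_a: "- ln a = ln rho - ln k"
      using rho \<open>0 < k\<close> by (simp add: a_def ln_div)
    have J: "expectation J \<le> ln rho - ln k" "ln rho - ln k - 1 \<le> expectation J"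
      using exponential_truncated_inverse[OF X a] unfolding J_def ln_a by auto
    have cJ: "c * expectation J \<le> c * (ln rho - ln k)" "c * (ln rho - ln k - 1) \<le> c * expectation J"
      using J pos by (auto intro!: mult_left_mono)
    have "expectation (\<lambda>\<omega>. rho * f \<omega>) \<le> expectation (\<lambda>\<omega>. c * J \<omega> + c + B / rho * Q \<omega>)"
      using int_f int_J int_Q bounds by (intro integral_mono) auto
    also have "\<dots> = c * expectation J + c + B / rho * expectation Q"
      using int_J int_Q by (simp add: prob_space)
    also have "\<dots> \<le> c * (ln rho - ln k) + c + B / k"
      using Q_le cJ by linarith
    finally have up: "rho * expectation f \<le> c * (ln rho - ln k) + c + B / k" by simp
    have "c * (ln rho - ln k - 1) - B / k \<le> c * expectation J - B / rho * expectation Q"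
      using Q_le cJ by linarith
    also have "\<dots> = expectation (\<lambda>\<omega>. c * J \<omega> - B / rho * Q \<omega>)"
      using int_J int_Q by simp
    also have "\<dots> \<le> expectation (\<lambda>\<omega>. rho * f \<omega>)"
      using int_f int_J int_Q bounds by (intro integral_mono) auto
    finally have lo: "c * (ln rho - ln k - 1) - B / k \<le> rho * expectation f" by simp
    have ln_k: "c * ln k \<le> c * \<bar>ln k\<bar>" "c * (- ln k) \<le> c * \<bar>ln k\<bar>"
      using pos by (intro mult_left_mono; simp)+
    have "\<bar>F - x\<bar> \<le> z + c + r"
      if "F \<le> x + y' + c + r" "x - y - c - r \<le> F" "y \<le> z" "y' \<le> z" for F x y y' z r
      using that by linarith
    moreover have "rho * expectation f \<le> c * ln rho + c * (- ln k) + c + B / k"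
      using up by (simp add: right_diff_distrib)
    moreover have "c * ln rho - c * ln k - c - B / k \<le> rho * expectation f"
      using lo by (simp add: right_diff_distrib)
    ultimately have "\<bar>rho * expectation f - c * ln rho\<bar> \<le> c * \<bar>ln k\<bar> + c + B / k"
      using ln_k by blast
    then show "\<bar>rho * expectation (\<lambda>\<omega>. if k / rho < X \<omega>
             then 1 - exp (- (c * ((b * (rho * X \<omega>) + 1) / (b * (rho * X \<omega>) - t)) / (rho * X \<omega>))) else 0)
            - c * ln rho\<bar> \<le> c * \<bar>ln k\<bar> + c + B / k"
      unfolding f_def[abs_def] a_def .
  qed
qed

section \<open>Independence and the limits of the scaled outage probability\<close>

text \<open>The restrictions of the family to \<open>J\<close> and to \<open>{i}\<close> are
  independent, so their joint law is a product; its image under \<open>f\<close> on one side and the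
  projection to \<open>i\<close> on the other is again a product. This separates
  \<open>(X, S)\<close> from \<open>Y\<close>.\<close>

lemma (in prob_space) distr_pair_of_indep_vars:
  assumes "indep_vars (\<lambda>_. borel) E I" "J \<subseteq> I" "i \<in> I" "i \<notin> J"
    and f[measurable]: "f \<in> measurable (Pi\<^sub>M J (\<lambda>_. borel)) K"
  shows "distr M (K \<Otimes>\<^sub>M borel) (\<lambda>\<omega>. (f (\<lambda>j\<in>J. E j \<omega>), E i \<omega>))
       = distr M K (\<lambda>\<omega>. f (\<lambda>j\<in>J. E j \<omega>)) \<Otimes>\<^sub>M distr M borel (E i)"
proof -
  have E_meas: "E j \<in> borel_measurable M" if "j \<in> I" for j
    using assms(1) that by (auto simp: indep_vars_def)
  define V where "V \<omega> = (\<lambda>j\<in>J. E j \<omega>)" for \<omega>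
  define W where "W \<omega> = (\<lambda>j\<in>{i}. E j \<omega>)" for \<omega>
  have [measurable]: "E i \<in> borel_measurable M" using assms(3) by (rule E_meas)
  have V[measurable]: "V \<in> measurable M (Pi\<^sub>M J (\<lambda>_. borel))"
    unfolding V_def using assms(2) E_meas by (intro measurable_restrict) auto
  have W[measurable]: "W \<in> measurable M (Pi\<^sub>M {i} (\<lambda>_. borel))"
    unfolding W_def using assms(3) E_meas by (intro measurable_restrict) auto
  have "indep_var (Pi\<^sub>M J (\<lambda>_. borel)) V (Pi\<^sub>M {i} (\<lambda>_. borel)) W"
    unfolding V_def W_def using assms by (intro indep_var_restrict[OF assms(1)]) auto
  then have VW: "distr M (Pi\<^sub>M J (\<lambda>_. borel)) V \<Otimes>\<^sub>M distr M (Pi\<^sub>M {i} (\<lambda>_. borel)) W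
      = distr M (Pi\<^sub>M J (\<lambda>_. borel) \<Otimes>\<^sub>M Pi\<^sub>M {i} (\<lambda>_. borel)) (\<lambda>\<omega>. (V \<omega>, W \<omega>))"
    by (simp add: indep_var_distribution_eq)
  interpret E: prob_space "distr M borel (E i)" by (rule prob_space_distr) simp
  have Ei: "distr (distr M (Pi\<^sub>M {i} (\<lambda>_. borel)) W) borel (\<lambda>x. x i) = distr M borel (E i)"
    by (subst distr_distr) (auto simp: o_def W_def)
  have fV: "distr (distr M (Pi\<^sub>M J (\<lambda>_. borel)) V) K f = distr M K (\<lambda>\<omega>. f (V \<omega>))"
    by (subst distr_distr) (auto simp: o_def)
  have "distr M K (\<lambda>\<omega>. f (V \<omega>)) \<Otimes>\<^sub>M distr M borel (E i)
     = distr (distr M (Pi\<^sub>M J (\<lambda>_. borel)) V \<Otimes>\<^sub>M distr M (Pi\<^sub>M {i} (\<lambda>_. borel)) W)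
          (K \<Otimes>\<^sub>M borel) (\<lambda>(x, y). (f x, y i))"
    unfolding fV[symmetric] Ei[symmetric]
    by (rule pair_measure_distr) (auto simp: Ei intro: E.sigma_finite_measure_axioms)
  also have "\<dots> = distr M (K \<Otimes>\<^sub>M borel) (\<lambda>\<omega>. (f (V \<omega>), E i \<omega>))"
    unfolding VW by (subst distr_distr) (auto simp: o_def, simp add: W_def)
  finally show ?thesis by (simp add: V_def)
qed

text \<open>For each fixed \<open>e\<close> the lower bound tends to \<open>?L\<close> and the upper
  bound to \<open>?L + t / b1 * e\<close>, because the limit of the conditional part is the same for
  every \<open>e\<close>. As \<open>e\<close> is arbitrary, the two meet.\<close>

lemma (in prob_space) scaled_outage_limit:
  fixes X Y S :: "'a \<Rightarrow> real"
  assumes X: "distributed M lborel X (exponential_density 1)" and X0: "\<And>\<omega>. 0 \<le> X \<omega>"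
    and Y: "distributed M lborel Y (exponential_density 1)" and Y0: "\<And>\<omega>. 0 \<le> Y \<omega>"
    and S: "AE \<omega> in M. 0 < S \<omega>"
    and S_meas: "S \<in> borel_measurable M"
    and indep: "distr M (borel \<Otimes>\<^sub>M borel) (\<lambda>\<omega>. ((X \<omega>, S \<omega>), Y \<omega>))
                = distr M borel (\<lambda>\<omega>. (X \<omega>, S \<omega>)) \<Otimes>\<^sub>M distr M borel Y"
    and int: "integrable M (\<lambda>\<omega>. 1 / S \<omega>)"
    and pos: "0 < b1" "0 < b2" "0 < t"
  shows "((\<lambda>rho. rho * \<P>(\<omega> in M. (b1 * rho * X \<omega>) * (b2 * rho * S \<omega> * Y \<omega>) /
                        (b1 * rho * X \<omega> + b2 * rho * S \<omega> * Y \<omega> + 1) < t))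
          \<longlongrightarrow> t / b1 + t / b2 * expectation (\<lambda>\<omega>. 1 / S \<omega>)) at_top"
    (is "(?F \<longlongrightarrow> ?L) at_top")
proof -
  have X_meas: "X \<in> borel_measurable M"
    using distributed_measurable[OF X] by simp
  define D where "D e rho = expectation (\<lambda>\<omega>. if t * (1 + e) / b1 / rho < X \<omega>
             then 1 - exp (- (t / b2 * ((b1 * (rho * X \<omega>) + 1) / (b1 * (rho * X \<omega>) - t)) / (rho * S \<omega>))) else 0)" for e rho
  have D: "((\<lambda>rho. rho * D e rho) \<longlongrightarrow> t / b2 * expectation (\<lambda>\<omega>. 1 / S \<omega>)) at_top" if "0 < e" for e
    unfolding D_def using that pos
    by (intro conditional_outage_limit X_meas S_meas AE_exponential_pos[OF X] S int) auto
  have E: "((\<lambda>rho. rho * (1 - exp (- (k / rho)))) \<longlongrightarrow> k) at_top" if "0 < k" for k :: real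
    using that by real_asymp
  have lo: "((\<lambda>rho. rho * (1 - exp (- (t / b1 / rho))) + rho * D e rho) \<longlongrightarrow> ?L) at_top" if "0 < e" for e
    using that pos by (intro tendsto_add E D) auto
  have up: "((\<lambda>rho. rho * (1 - exp (- (t * (1 + e) / b1 / rho))) + rho * D e rho) \<longlongrightarrow> ?L + t / b1 * e) at_top"
    if "0 < e" for e
  proof -
    have "((\<lambda>rho. rho * (1 - exp (- (t * (1 + e) / b1 / rho))) + rho * D e rho)
       \<longlongrightarrow> t * (1 + e) / b1 + t / b2 * expectation (\<lambda>\<omega>. 1 / S \<omega>)) at_top"
      using that pos by (intro tendsto_add E D) auto
    also have "t * (1 + e) / b1 + t / b2 * expectation (\<lambda>\<omega>. 1 / S \<omega>) = ?L + t / b1 * e"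
      by (simp add: distrib_left add_divide_distrib)
    finally show ?thesis .
  qed
  have bounds: "rho * (1 - exp (- (t / b1 / rho))) + rho * D e rho \<le> ?F rho"
               "?F rho \<le> rho * (1 - exp (- (t * (1 + e) / b1 / rho))) + rho * D e rho" if "0 < e" "0 < rho" for e rho
    using mult_left_mono[OF outage_sandwich(1)[OF X X0 Y Y0 S S_meas indep pos that], of rho]
      mult_left_mono[OF outage_sandwich(2)[OF X X0 Y Y0 S S_meas indep pos that], of rho] that
    unfolding D_def distrib_left by auto
  show ?thesis
  proof (rule order_tendstoI)
    fix l assume "l < ?L"
    from order_tendstoD(1)[OF lo this, OF zero_less_one] eventually_gt_at_top[of 0]
    show "\<forall>\<^sub>F rho in at_top. l < ?F rho"
      by eventually_elim (use bounds(1)[OF zero_less_one] in \<open>fastforce intro: less_le_trans\<close>)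
  next
    fix l assume l: "?L < l"
    \<comment> \<open>Chosen so that the surplus \<open>t / b1 * e\<close> is half the gap between
      \<open>?L\<close> and \<open>l\<close>.\<close>
    define e where "e = (l - ?L) / (2 * (t / b1))"
    have "0 < e" using l pos by (simp add: e_def)
    have half: "x + y < l" if "y = (l - x) / 2" "x < l" for x y :: real
      using that by simp
    have "?L + t / b1 * e < l" by (rule half[OF _ l]) (use pos in \<open>simp add: e_def\<close>)
    from order_tendstoD(2)[OF up[OF \<open>0 < e\<close>] this] eventually_gt_at_top[of 0]
    show "\<forall>\<^sub>F rho in at_top. ?F rho < l"
      by eventually_elim (use bounds(2)[OF \<open>0 < e\<close>] in \<open>fastforce intro: le_less_trans\<close>)
  qed
qed

text \<open>Here the single choice \<open>e = 1\<close> suffices: after scaling by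
  \<open>rho\<close>, the contribution of small \<open>X\<close> is bounded and disappears on
  division by \<open>ln rho\<close>.\<close>

lemma (in prob_space) scaled_outage_log_limit:
  fixes X Y S :: "'a \<Rightarrow> real"
  assumes X: "distributed M lborel X (exponential_density 1)" and X0: "\<And>\<omega>. 0 \<le> X \<omega>"
    and Y: "distributed M lborel Y (exponential_density 1)" and Y0: "\<And>\<omega>. 0 \<le> Y \<omega>"
    and S: "\<And>\<omega>. S \<omega> = a * X \<omega>"
    and indep: "distr M (borel \<Otimes>\<^sub>M borel) (\<lambda>\<omega>. ((X \<omega>, S \<omega>), Y \<omega>))
                = distr M borel (\<lambda>\<omega>. (X \<omega>, S \<omega>)) \<Otimes>\<^sub>M distr M borel Y"
    and pos: "0 < b1" "0 < b2" "0 < t" "0 < a"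
  shows "((\<lambda>rho. rho * \<P>(\<omega> in M. (b1 * rho * X \<omega>) * (b2 * rho * S \<omega> * Y \<omega>) /
                        (b1 * rho * X \<omega> + b2 * rho * S \<omega> * Y \<omega> + 1) < t) / ln rho)
          \<longlongrightarrow> t / b2 / a) at_top"
    (is "((\<lambda>rho. ?F rho / ln rho) \<longlongrightarrow> _) at_top")
proof -
  have X_meas[measurable]: "X \<in> borel_measurable M"
    using distributed_measurable[OF X] by simp
  have S_pos: "AE \<omega> in M. 0 < S \<omega>"
    using AE_exponential_pos[OF X] by eventually_elim (simp add: S pos)
  have S_meas: "S \<in> borel_measurable M" unfolding S[abs_def] by measurable
  define c where "c = t / b2 / a"
  have "0 < c" using pos by (simp add: c_def)
  define k where "k = t * (1 + 1) / b1"
  have "0 < k" using pos by (simp add: k_def)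
  define D where "D rho = expectation (\<lambda>\<omega>. if k / rho < X \<omega>
             then 1 - exp (- (c * ((b1 * (rho * X \<omega>) + 1) / (b1 * (rho * X \<omega>) - t)) / (rho * X \<omega>))) else 0)" for rho
  obtain K where K: "\<And>rho. max 1 k \<le> rho \<Longrightarrow> \<bar>rho * D rho - c * ln rho\<bar> \<le> K"
    using conditional_outage_log_asymptotics[OF X pos(1,3) zero_less_one \<open>0 < c\<close>]
    unfolding D_def k_def by blast
  have scale: "t / b2 * r / (rho * (a * x)) = c * r / (rho * x)" for r rho x
    by (simp add: c_def mult_ac)
  have D_eq: "expectation (\<lambda>\<omega>. if k / rho < X \<omega>
      then 1 - exp (- (t / b2 * ((b1 * (rho * X \<omega>) + 1) / (b1 * (rho * X \<omega>) - t)) / (rho * S \<omega>))) else 0) = D rho" for rho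
    unfolding D_def S scale ..
  note sandwich = outage_sandwich[OF X X0 Y Y0 S_pos S_meas indep pos(1-3) zero_less_one,
      folded k_def, unfolded D_eq]
  have bounds: "c * ln rho - K \<le> ?F rho \<and> ?F rho \<le> k + K + c * ln rho" if rho: "max 1 k \<le> rho" for rho
  proof -
    have "0 < rho" using rho by simp
    have k_rho: "0 \<le> k / rho" and t_rho: "0 \<le> t / b1 / rho" using \<open>0 < k\<close> \<open>0 < rho\<close> pos by auto
    have "D rho \<le> 1 - exp (- (t / b1 / rho)) + D rho" using one_minus_exp_bounds(3)[OF t_rho] by simp
    also note sandwich(1)[OF \<open>0 < rho\<close>]
    finally have lo: "rho * D rho \<le> ?F rho" using \<open>0 < rho\<close> by simp
    note sandwich(2)[OF \<open>0 < rho\<close>]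
    also have "1 - exp (- (k / rho)) + D rho \<le> k / rho + D rho"
      using one_minus_exp_bounds(1)[OF k_rho] by simp
    finally have "?F rho \<le> rho * (k / rho + D rho)" using \<open>0 < rho\<close> by (intro mult_left_mono) auto
    also have "\<dots> = k + rho * D rho" using \<open>0 < rho\<close> by (simp add: distrib_left)
    finally show ?thesis using lo K[OF rho] by linarith
  qed
  have "((\<lambda>rho. ?F rho / ln rho) \<longlongrightarrow> c) at_top"
  proof (rule tendsto_sandwich)
    show "((\<lambda>rho. (c * ln rho - K) / ln rho) \<longlongrightarrow> c) at_top"
         "((\<lambda>rho. (k + K + c * ln rho) / ln rho) \<longlongrightarrow> c) at_top"
      by real_asymp+
    have ev: "\<forall>\<^sub>F rho in at_top. max 1 k \<le> rho \<and> 0 < ln rho"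
      by (intro eventually_conj eventually_ge_at_top) real_asymp
    from ev show "\<forall>\<^sub>F rho in at_top. (c * ln rho - K) / ln rho \<le> ?F rho / ln rho"
      by eventually_elim (intro divide_right_mono; use bounds in auto)
    from ev show "\<forall>\<^sub>F rho in at_top. ?F rho / ln rho \<le> (k + K + c * ln rho) / ln rho"
      by eventually_elim (intro divide_right_mono; use bounds in auto)
  qed
  then show ?thesis by (simp add: c_def)
qed

section \<open>The outage probability against its approximation\<close>

lemma gammaS_eq:
  fixes eta theta d1 d2 tau sigma1 lam1 :: real
  defines "b1 \<equiv> (1 - theta) * lam1 / d1 powr tau"
    and "b2 \<equiv> eta * theta * sigma1 / (d1 powr tau * d2 powr tau)"
  shows "gammaS eta theta d1 d2 tau sigma1 lam1 rho S G Q
       = (b1 * rho * G) * (b2 * rho * S * Q) / (b1 * rho * G + b2 * rho * S * Q + 1)"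
proof -
  have d: "d1 powr (2 * tau) = d1 powr tau * d1 powr tau"
    by (simp add: powr_add[symmetric])
  have "eta * theta * (1 - theta) * rho\<^sup>2 / (d1 powr (2 * tau) * d2 powr tau) * S * lam1 * G * sigma1 * Q
      = (b1 * rho * G) * (b2 * rho * S * Q)"
    unfolding d b1_def b2_def power2_eq_square by (simp add: mult_ac)
  moreover have "eta * theta * rho / (d1 powr tau * d2 powr tau) * S * sigma1 * Q
      + (1 - theta) * rho / d1 powr tau * lam1 * G + 1 = b1 * rho * G + b2 * rho * S * Q + 1"
    unfolding b1_def b2_def by (simp add: mult_ac)
  ultimately show ?thesis unfolding gammaS_def by simp
qed

theorem theorem6:
  fixes M :: "'a measure" and N :: nat
    and g :: "nat \<Rightarrow> 'a \<Rightarrow> complex" and q :: "'a \<Rightarrow> complex"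
    and lam :: "nat \<Rightarrow> real"
    and eta theta d1 d2 tau gth sigma1 :: real
  assumes "prob_space M"
    and "N \<ge> 1"
    and "0 < eta" "eta \<le> 1" "0 < theta" "theta < 1"
    and "0 < d1" "0 < d2" "0 < tau" "0 < gth" "0 < sigma1"
    and "\<And>i. 1 \<le> i \<Longrightarrow> i \<le> N \<Longrightarrow> 0 < lam i"
    and "\<And>i j. 1 \<le> i \<Longrightarrow> i \<le> j \<Longrightarrow> j \<le> N \<Longrightarrow> lam j \<le> lam i"
    and "\<And>i j. i \<in> {1..N} \<Longrightarrow> j \<in> {1..N} \<Longrightarrow> i \<noteq> j \<Longrightarrow> lam i \<noteq> lam j"
    and "prob_space.indep_vars M (\<lambda>_. borel) (\<lambda>k. if k = 0 then q else g k) {0..N}"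
    and "\<And>i. 1 \<le> i \<Longrightarrow> i \<le> N \<Longrightarrow> distributed M lborel (g i) cscg_density"
    and "distributed M lborel q cscg_density"
  shows "((\<lambda>rho. outage_prob M N g q lam eta theta d1 d2 tau sigma1 gth rho
                 / approxA N lam eta theta d1 d2 tau sigma1 gth rho) \<longlongrightarrow> 1) at_top
         \<and> (N \<ge> 2 \<longrightarrow> (\<exists>c>0. ((\<lambda>rho. rho * outage_prob M N g q lam eta theta d1 d2 tau sigma1 gth rho)
                                 \<longlongrightarrow> c) at_top))"
proof -
  interpret prob_space M by fact
  define b1 where "b1 = (1 - theta) * lam 1 / d1 powr tau"
  define b2 where "b2 = eta * theta * sigma1 / (d1 powr tau * d2 powr tau)"
  define Z where "Z = gth / b2"
  \<comment> \<open>Index \<open>0\<close> stands for \<open>q\<close>, so that one independent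
    family contains \<open>X = E 1\<close>, the summands of \<open>S\<close> and
    \<open>Y = E 0\<close>.\<close>
  define E where "E k \<omega> = (cmod ((if k = 0 then q else g k) \<omega>))\<^sup>2" for k \<omega>
  define S where "S \<omega> = (\<Sum>i=1..N. lam i * E i \<omega>)" for \<omega>
  define out where "out = outage_prob M N g q lam eta theta d1 d2 tau sigma1 gth"
  define A where "A = approxA N lam eta theta d1 d2 tau sigma1 gth"
  define c where "c i = lam i powi (int N - 2) / (\<Prod>j\<in>{1..N} - {i}. lam i - lam j)" for i
  have lam: "0 < lam i" if "i \<in> {1..N}" for i
    using assms(12) that by simp
  have inj: "inj_on lam {1..N}"
    by (rule inj_onI) (use assms(14) in blast)
  have lam1: "0 < lam 1" using assms(2) lam by simp
  have pos: "0 < b1" "0 < b2" "0 < gth"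
    using assms lam1 by (auto simp: b1_def b2_def)
  have "0 < Z" using pos by (simp add: Z_def)
  have E0: "0 \<le> E k \<omega>" for k \<omega> by (simp add: E_def)
  have E_exp: "distributed M lborel (E k) (exponential_density 1)" if "k \<in> {0..N}" for k
    unfolding E_def[abs_def] using that assms(16,17) by (intro exponential_cmod_squared) auto
  have E_indep: "indep_vars (\<lambda>_. borel) E {0..N}"
    unfolding E_def[abs_def] by (rule indep_vars_compose2[OF assms(15)]) simp
  have E_meas[measurable]: "E k \<in> borel_measurable M" if "k \<in> {0..N}" for k
    using distributed_measurable[OF E_exp[OF that]] by simp
  have S_meas: "S \<in> borel_measurable M" unfolding S_def by measurable
  have N1: "1 \<in> {0..N}" "1 \<in> {1..N}" "0 \<in> {0..N}" using assms(2) by auto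
  have S_pos: "AE \<omega> in M. 0 < S \<omega>"
    using AE_exponential_pos[OF E_exp[OF N1(1)]]
  proof eventually_elim
    case (elim \<omega>)
    show ?case unfolding S_def
      by (rule sum_pos2[OF _ N1(2)]) (use elim lam lam1 E0 in \<open>auto simp: less_imp_le\<close>)
  qed
  have indep: "distr M (borel \<Otimes>\<^sub>M borel) (\<lambda>\<omega>. ((E 1 \<omega>, S \<omega>), E 0 \<omega>))
      = distr M borel (\<lambda>\<omega>. (E 1 \<omega>, S \<omega>)) \<Otimes>\<^sub>M distr M borel (E 0)"
  proof -
    have "(\<lambda>x. (x 1, \<Sum>i=1..N. lam i * x i)) \<in> measurable (Pi\<^sub>M {1..N} (\<lambda>_. borel)) (borel :: (real \<times> real) measure)"
      unfolding borel_prod[symmetric] using N1 by measurable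
    from distr_pair_of_indep_vars[OF E_indep _ _ _ this, of 0] show ?thesis
      using N1 by (simp add: S_def)
  qed
  have S_eq: "S \<omega> = (\<Sum>i=1..N. lam i * (cmod (g i \<omega>))\<^sup>2)" for \<omega>
    unfolding S_def by (intro sum.cong) (auto simp: E_def)
  have out_eq: "out rho = \<P>(\<omega> in M. (b1 * rho * E 1 \<omega>) * (b2 * rho * S \<omega> * E 0 \<omega>) /
                        (b1 * rho * E 1 \<omega> + b2 * rho * S \<omega> * E 0 \<omega> + 1) < gth)" for rho
    unfolding out_def outage_prob_def gammaS_eq b1_def[symmetric] b2_def[symmetric] S_eq
    by (simp add: E_def)
  have A_eq: "rho * A rho = gth / b1 - (\<Sum>i=1..N. c i * Z * ln (Z / (lam i * rho)))" if "0 < rho" for rho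
  proof -
    have "d1 powr tau * d2 powr tau * gth / (eta * theta * sigma1) = Z"
      by (simp add: Z_def b2_def)
    moreover have "gth * d1 powr tau / ((1 - theta) * lam 1) = gth / b1"
      by (simp add: b1_def)
    ultimately show ?thesis
      unfolding A_def approxA_def Let_def c_def using that by simp
  qed
  have "((\<lambda>rho. out rho / A rho) \<longlongrightarrow> 1) at_top \<and>
    (N \<ge> 2 \<longrightarrow> (\<exists>c>0. ((\<lambda>rho. rho * out rho) \<longlongrightarrow> c) at_top))"
  proof (cases "N \<ge> 2")
    case True
    define m where "m = (\<Sum>i=1..N. c i * ln (lam i))"
    define L where "L = gth / b1 + Z * m"
    have card: "card {1..N} \<ge> 2" using True by simp
    have sum_c: "(\<Sum>i=1..N. c i) = 0"
      using sum_powi_over_differences_eq_0[OF _ card inj lam] by (simp add: c_def)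
    have nn: "(\<integral>\<^sup>+\<omega>. ennreal (1 / S \<omega>) \<partial>M) = ennreal m"
      unfolding S_def m_def c_def
      using inverse_moment_weighted_exponentials[OF _ card inj lam, of E] E_exp
        indep_vars_subset[OF E_indep, of "{1..N}"] by simp
    have S0: "0 \<le> 1 / S \<omega>" for \<omega>
      unfolding S_def using lam E0 by (auto intro!: sum_nonneg simp: less_imp_le)
    have int: "integrable M (\<lambda>\<omega>. 1 / S \<omega>)"
      using nn S0 S_meas by (intro integrableI_nonneg) auto
    \<comment> \<open>The equation \<open>nn\<close> alone does not give the sign, since
      \<open>ennreal\<close> sends negative numbers to \<open>0\<close>. A negative \<open>m\<close>
      would make \<open>1 / S\<close> vanish almost everywhere, against the positivity of
      \<open>S\<close>.\<close>
    have "0 \<le> m"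
    proof (rule ccontr)
      assume "\<not> 0 \<le> m"
      then have "(\<integral>\<^sup>+\<omega>. ennreal (1 / S \<omega>) \<partial>M) = 0" using nn by (simp add: ennreal_neg)
      then have "AE \<omega> in M. ennreal (1 / S \<omega>) = 0"
        using S_meas by (subst (asm) nn_integral_0_iff_AE) auto
      with S_pos have "AE \<omega> in M. False"
        by eventually_elim (simp add: ennreal_eq_0_iff)
      then show False by simp
    qed
    then have m: "expectation (\<lambda>\<omega>. 1 / S \<omega>) = m"
      using nn S0 S_meas by (subst integral_eq_nn_integral) auto
    have "0 < L" using pos \<open>0 < Z\<close> \<open>0 \<le> m\<close> by (simp add: L_def add_pos_nonneg)
    have lim: "((\<lambda>rho. rho * out rho) \<longlongrightarrow> L) at_top"
      using scaled_outage_limit[OF E_exp[OF N1(1)] E0 E_exp[OF N1(3)] E0 S_pos S_meas indep int pos]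
      unfolding out_eq L_def m Z_def .
    have "((\<lambda>rho. rho * out rho / L) \<longlongrightarrow> L / L) at_top"
      using lim \<open>0 < L\<close> by (intro tendsto_intros) auto
    then have "((\<lambda>rho. rho * out rho / L) \<longlongrightarrow> 1) at_top"
      using \<open>0 < L\<close> by simp
    moreover have "\<forall>\<^sub>F rho in at_top. rho * out rho / L = out rho / A rho"
      using eventually_gt_at_top[of 0]
    proof eventually_elim
      case (elim rho)
      \<comment> \<open>The terms with \<open>ln Z\<close> and \<open>ln rho\<close> multiply the
        sum of the \<open>c i\<close>, which is \<open>0\<close>; hence \<open>rho * A rho\<close>
        equals \<open>L\<close> for every positive \<open>rho\<close>, not merely in the
        limit.\<close>
      have "(\<Sum>i=1..N. c i * Z * ln (Z / (lam i * rho)))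
          = (\<Sum>i=1..N. Z * (ln Z - ln rho) * c i - Z * (c i * ln (lam i)))"
      proof (rule sum.cong[OF refl])
        fix i assume i: "i \<in> {1..N}"
        show "c i * Z * ln (Z / (lam i * rho)) = Z * (ln Z - ln rho) * c i - Z * (c i * ln (lam i))"
          using lam[OF i] elim \<open>0 < Z\<close> by (simp add: ln_div ln_mult algebra_simps)
      qed
      also have "\<dots> = - (Z * m)"
        unfolding sum_subtractf sum_distrib_left[symmetric] sum_c m_def by simp
      finally have "rho * A rho = L" using A_eq[OF elim] by (simp add: L_def)
      then show ?case using elim by auto
    qed
    ultimately have "((\<lambda>rho. out rho / A rho) \<longlongrightarrow> 1) at_top"
      by (rule Lim_transform_eventually)
    then show ?thesis using lim \<open>0 < L\<close> by blast
  next
    case False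
    then have N: "N = 1" using assms(2) by simp
    have S: "S \<omega> = lam 1 * E 1 \<omega>" for \<omega> by (simp add: S_def N)
    have lim: "((\<lambda>rho. rho * out rho / ln rho) \<longlongrightarrow> Z / lam 1) at_top"
      using scaled_outage_log_limit[OF E_exp[OF N1(1)] E0 E_exp[OF N1(3)] E0 S indep pos lam1]
      unfolding out_eq Z_def .
    \<comment> \<open>For \<open>N = 1\<close> the exponent is \<open>-1\<close> and the product is
      empty.\<close>
    have c1: "c 1 = 1 / lam 1" by (simp add: c_def N power_int_minus inverse_eq_divide)
    have "((\<lambda>rho. (gth / b1 - 1 / lam 1 * Z * ln (Z / (lam 1 * rho))) / ln rho) \<longlongrightarrow> Z / lam 1) at_top"
      using lam1 \<open>0 < Z\<close> by (real_asymp simp: field_simps)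
    moreover have "\<forall>\<^sub>F rho in at_top. (gth / b1 - 1 / lam 1 * Z * ln (Z / (lam 1 * rho))) / ln rho = rho * A rho / ln rho"
      using eventually_gt_at_top[of 0] by eventually_elim (simp add: A_eq N c1[simplified])
    ultimately have "((\<lambda>rho. rho * A rho / ln rho) \<longlongrightarrow> Z / lam 1) at_top"
      by (rule Lim_transform_eventually)
    from tendsto_divide[OF lim this] have "((\<lambda>rho. (rho * out rho / ln rho) / (rho * A rho / ln rho))
        \<longlongrightarrow> (Z / lam 1) / (Z / lam 1)) at_top"
      using lam1 \<open>0 < Z\<close> by simp
    then have "((\<lambda>rho. (rho * out rho / ln rho) / (rho * A rho / ln rho)) \<longlongrightarrow> 1) at_top"
      using lam1 \<open>0 < Z\<close> by simp
    \<comment> \<open>Beyond \<open>1\<close> both \<open>rho\<close> and \<open>ln rho\<close> are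
      nonzero and cancel.\<close>
    moreover have "\<forall>\<^sub>F rho in at_top. (rho * out rho / ln rho) / (rho * A rho / ln rho) = out rho / A rho"
      using eventually_gt_at_top[of 1] by eventually_elim simp
    ultimately have "((\<lambda>rho. out rho / A rho) \<longlongrightarrow> 1) at_top"
      by (rule Lim_transform_eventually)
    then show ?thesis using False by simp
  qed
  then show ?thesis unfolding out_def A_def .
qed

end
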